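(* Let $G$ be an amenable locally compact second-countable group and let $d$ be a compatible left-invariant metric on $G$. Assume that $G$ has no non-trivial continuous homomorphisms $G\to\mathbb{R}$. Then, for every compact subset $C\subseteq G$ and every $\epsilon>0$, there is a compactly supported $f\in L^1_{d,+,1}(G)$ such that $$\mathsf{W}(R_yf,R_zf)<\epsilon$$ for all $y,z\in C$.
   Context: $G$ is equipped with its left Haar measure $dx$, and $L^1(G)$ is the corresponding space of real-valued integrable functions. A metric is compatible if it induces the topology of $G$. Define $$L^1_{d,+,1}(G)=\Big\{f\in L^1(G)\ \Big|\ f\ge 0,\ \|f\|_{L^1}=1,\ \int d(x,1)f(x)\,dx<\infty\Big\}.$$ For $y\in G$, $R_yf$ is the function $R_yf(x)=f(xy)$. (When $G$ has no non-trivial continuous homomorphisms to $\mathbb R$, $G$ is unimodular and $R_yf\in L^1_{d,+,1}(G)$ for $f\in L^1_{d,+,1}(G)$.) For $f,h\in L^1_{d,+,1}(G)$, the Wasserstein distance is $$\mathsf{W}(f,h)=\inf_\eta\int_{G\times G}d(x,y)\,d\eta(x,y),$$ where the infimum is over all Borel probability measures $\eta$ on $G\times G$ whose marginals are $f\,dx$ and $h\,dx$. A topological group $G$ is amenable if every continuous affine action of $G$ on a non-empty compact convex subset of a locally convex topological vector space has a fixed point (for locally compact groups this is the usual notion of amenability). *)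

theory Defs
  imports "HOL-Probability.Probability" "HOL-Algebra.Module"
begin

text \<open>
  Groups are types of class \<^class>\<open>topological_group_add\<close>. Despite the additive notation this
  class is not commutative: \<open>x + y\<close> is the product \<open>xy\<close>, \<open>0\<close> is the neutral element and
  \<open>- x\<close> is the inverse.
\<close>

definition left_invariant_metric :: "('a::group_add \<Rightarrow> 'a \<Rightarrow> real) \<Rightarrow> bool" where
  "left_invariant_metric d \<longleftrightarrow>
     Metric_space UNIV d \<and> (\<forall>g x y. d (g + x) (g + y) = d x y)"

definition compatible_metric :: "('a::topological_space \<Rightarrow> 'a \<Rightarrow> real) \<Rightarrow> bool" where
  "compatible_metric d \<longleftrightarrow> Metric_space UNIV d \<and> Metric_space.mtopology UNIV d = euclidean"

definition left_Haar_measure :: "('a::{topological_group_add,t2_space}) measure \<Rightarrow> bool" where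
  "left_Haar_measure \<mu> \<longleftrightarrow>
     sets \<mu> = sets borel \<and>
     emeasure \<mu> UNIV \<noteq> 0 \<and>
     (\<forall>K. compact K \<longrightarrow> emeasure \<mu> K < \<infinity>) \<and>
     (\<forall>A\<in>sets borel. emeasure \<mu> A = (INF U\<in>{U. open U \<and> A \<subseteq> U}. emeasure \<mu> U)) \<and>
     (\<forall>U. open U \<longrightarrow> emeasure \<mu> U = (SUP K\<in>{K. compact K \<and> K \<subseteq> U}. emeasure \<mu> K)) \<and>
     (\<forall>g. \<forall>A\<in>sets borel. emeasure \<mu> ((\<lambda>x. g + x) ` A) = emeasure \<mu> A)"

definition no_nontrivial_real_hom :: "'a::topological_group_add itself \<Rightarrow> bool" where
  "no_nontrivial_real_hom _ \<longleftrightarrow>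
     (\<forall>\<phi> :: 'a \<Rightarrow> real.
        continuous_on UNIV \<phi> \<and> (\<forall>x y. \<phi> (x + y) = \<phi> x + \<phi> y) \<longrightarrow> (\<forall>x. \<phi> x = 0))"

definition real_ring :: "real ring" where
  "real_ring = \<lparr>carrier = UNIV, mult = (*), one = 1, zero = 0, add = (+)\<rparr>"

lemma cring_real_ring: "cring real_ring"
proof (rule cringI)
  have "\<exists>y. y + x = 0" for x :: real
    by (rule exI[of _ "- x"]) simp
  then show "abelian_group real_ring"
    by (intro abelian_groupI) (auto simp: real_ring_def)
  show "comm_monoid real_ring"
    by (rule comm_monoidI) (auto simp: real_ring_def)
qed (auto simp: real_ring_def algebra_simps)

definition convex_in :: "(real, 'v) module \<Rightarrow> 'v set \<Rightarrow> bool" where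
  "convex_in V K \<longleftrightarrow> K \<subseteq> carrier V \<and>
     (\<forall>x\<in>K. \<forall>y\<in>K. \<forall>t\<in>{0..1}. ((1 - t) \<odot>\<^bsub>V\<^esub> x) \<oplus>\<^bsub>V\<^esub> (t \<odot>\<^bsub>V\<^esub> y) \<in> K)"

text \<open>
  The Hausdorff axiom is part of the definition, as usual in this context: without it every
  group would act continuously and affinely on the (compact, convex, indiscrete) set of its
  finitely supported probability measures, without a fixed point unless the group is finite.
\<close>

definition locally_convex_tvs :: "(real, 'v) module \<Rightarrow> 'v topology \<Rightarrow> bool" where
  "locally_convex_tvs V T \<longleftrightarrow>
     module real_ring V \<and>
     topspace T = carrier V \<and>
     Hausdorff_space T \<and>
     continuous_map (prod_topology T T) T (\<lambda>(x, y). x \<oplus>\<^bsub>V\<^esub> y) \<and>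
     continuous_map (prod_topology euclideanreal T) T (\<lambda>(a, x). a \<odot>\<^bsub>V\<^esub> x) \<and>
     (\<forall>U. openin T U \<and> \<zero>\<^bsub>V\<^esub> \<in> U \<longrightarrow>
        (\<exists>W. openin T W \<and> \<zero>\<^bsub>V\<^esub> \<in> W \<and> W \<subseteq> U \<and> convex_in V W))"

definition continuous_affine_action ::
  "(real, 'v) module \<Rightarrow> 'v topology \<Rightarrow> 'v set \<Rightarrow> ('a::topological_group_add \<Rightarrow> 'v \<Rightarrow> 'v) \<Rightarrow> bool"
where
  "continuous_affine_action V T K \<alpha> \<longleftrightarrow>
     (\<forall>g. \<forall>x\<in>K. \<alpha> g x \<in> K) \<and>
     (\<forall>x\<in>K. \<alpha> 0 x = x) \<and>
     (\<forall>g h. \<forall>x\<in>K. \<alpha> (g + h) x = \<alpha> g (\<alpha> h x)) \<and>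
     (\<forall>g. \<forall>x\<in>K. \<forall>y\<in>K. \<forall>t\<in>{0..1}.
        \<alpha> g (((1 - t) \<odot>\<^bsub>V\<^esub> x) \<oplus>\<^bsub>V\<^esub> (t \<odot>\<^bsub>V\<^esub> y)) =
          ((1 - t) \<odot>\<^bsub>V\<^esub> \<alpha> g x) \<oplus>\<^bsub>V\<^esub> (t \<odot>\<^bsub>V\<^esub> \<alpha> g y)) \<and>
     continuous_map (prod_topology euclidean (subtopology T K)) (subtopology T K)
       (\<lambda>(g, x). \<alpha> g x)"

definition affine_fixed_point_property ::
  "'a::topological_group_add itself \<Rightarrow> 'v itself \<Rightarrow> bool"
where
  "affine_fixed_point_property _ _ \<longleftrightarrow>
     (\<forall>(V :: (real, 'v) module) T K (\<alpha> :: 'a \<Rightarrow> 'v \<Rightarrow> 'v).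
        locally_convex_tvs V T \<and> K \<noteq> {} \<and> compactin T K \<and> convex_in V K \<and>
        continuous_affine_action V T K \<alpha> \<longrightarrow>
        (\<exists>x\<in>K. \<forall>g. \<alpha> g x = x))"

text \<open>
  A formula cannot quantify over types, so amenability is the fixed point property for all
  locally convex spaces whose underlying set is a subset of the universe
  \<open>('a \<Rightarrow> real) \<Rightarrow> real\<close>. For second countable locally compact groups nothing is lost. If such a
  group acts on \<open>K\<close>, the closed convex hull of an orbit is invariant and separable, hence has
  weight at most the continuum; it therefore embeds affinely in a power of the reals with
  continuum many factors, a space of cardinality at most that of the universe. Alternatively, the
  universe contains the dual of the bounded uniformly continuous functions with its weak-*
  topology, in which the invariant means live.
\<close>

definition amenable :: "'a::topological_group_add itself \<Rightarrow> bool" where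
  "amenable G \<longleftrightarrow> affine_fixed_point_property G TYPE(('a \<Rightarrow> real) \<Rightarrow> real)"

text \<open>Elements of \<open>L\<^sup>1\<close> are given by representatives.\<close>

definition L1_d_plus_1 :: "('a::group_add) measure \<Rightarrow> ('a \<Rightarrow> 'a \<Rightarrow> real) \<Rightarrow> ('a \<Rightarrow> real) set" where
  "L1_d_plus_1 \<mu> d =
     {f. integrable \<mu> f \<and> (AE x in \<mu>. 0 \<le> f x) \<and> (\<integral>x. \<bar>f x\<bar> \<partial>\<mu>) = 1 \<and>
         (\<integral>\<^sup>+x. ennreal (d x 0 * f x) \<partial>\<mu>) < \<infinity>}"

definition right_translate :: "'a::group_add \<Rightarrow> ('a \<Rightarrow> real) \<Rightarrow> 'a \<Rightarrow> real" where
  "right_translate y f = (\<lambda>x. f (x + y))"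

definition couplings ::
  "('a::topological_space) measure \<Rightarrow> ('a \<Rightarrow> real) \<Rightarrow> ('a \<Rightarrow> real) \<Rightarrow> ('a \<times> 'a) measure set"
where
  "couplings \<mu> f h =
     {\<eta>. sets \<eta> = sets borel \<and> prob_space \<eta> \<and>
         distr \<eta> borel fst = density \<mu> (\<lambda>x. ennreal (f x)) \<and>
         distr \<eta> borel snd = density \<mu> (\<lambda>x. ennreal (h x))}"

definition Wasserstein ::
  "('a::topological_space) measure \<Rightarrow> ('a \<Rightarrow> 'a \<Rightarrow> real) \<Rightarrow> ('a \<Rightarrow> real) \<Rightarrow> ('a \<Rightarrow> real) \<Rightarrow> ennreal"
where
  "Wasserstein \<mu> d f h = (INF \<eta>\<in>couplings \<mu> f h. \<integral>\<^sup>+(x, y). ennreal (d x y) \<partial>\<eta>)"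

end

theory Submission
  imports Defs "HOL-Library.Function_Algebras"
begin

text \<open>
  Replacing \<open>f\<close> by a mixture of left translates of a bump function near the identity and the compact
  set by a finite set \<open>S\<close>, one looks for a finite multiset \<open>w\<close> of points such that for all \<open>y, z\<close> in
  \<open>S\<close> the multisets \<open>w y\<close> and \<open>w z\<close> can be matched at small average cost. If there is none, linear
  programming duality yields functions \<open>F\<^sub>i\<close>, one for each pair \<open>i = (y, z)\<close>, that are 1-Lipschitz
  and satisfy \<open>\<Sum>\<^sub>i (F\<^sub>i (g z) - F\<^sub>i (g y)) \<ge> \<epsilon>\<close> for all \<open>g\<close>. Modulo constants these families form a
  compact convex set on which \<open>G\<close> acts by left translation, and a fixed point consists of
  continuous homomorphisms to the reals. These vanish, which is absurd. The modular function is
  trivial for the same reason, so that right translation preserves Haar measure.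
\<close>

subsection \<open>Additive functionals below a submonoid\<close>

text \<open>By left invariance \<open>d (x + y) (x + z) = d y z\<close> for every \<open>x\<close>,
  so matching each point with itself always costs \<open>d y z\<close>, however \<open>f\<close> is
  spread out. Small cost needs a rearrangement, and the same \<open>w\<close> has to serve all
  pairs. Therefore the costs are added over the pairs before dualising; as they are nonnegative, a
  small sum makes each of them small.

  Matchings have integer multiplicities and carry no topology, so the duality is an additive
  Hahn-Banach argument. The dual functions may be unbounded, but a 1-Lipschitz function vanishing at
  the identity satisfies \<open>\<bar>F x\<bar> \<le> d x 0\<close>, and this pointwise bound
  suffices for compactness in the product topology. The dual inequality involves right
  multiplication and is required for all \<open>g\<close>, so left translation only permutes its
  instances; left invariance of \<open>d\<close> preserves the Lipschitz bound.\<close>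

lemma sum_const_lessThan_add:
  fixes x :: "'v::ab_group_add" and m n :: nat
  shows "(\<Sum>i<m. x) + (\<Sum>i<n. x) = (\<Sum>i<m + n. x)"
  by (induction n) (simp_all add: algebra_simps)

lemma sum_const_lessThan_mem:
  fixes x :: "'v::ab_group_add" and n :: nat
  assumes "0 \<in> S" "\<And>u v. u \<in> S \<Longrightarrow> v \<in> S \<Longrightarrow> u + v \<in> S" "x \<in> S"
  shows "(\<Sum>i<n. x) \<in> S"
  by (induction n) (simp_all add: assms)

lemma sum_const_lessThan_Pair:
  fixes x :: "'v::ab_group_add \<times> real" and n :: nat
  shows "(\<Sum>i<n. x) = (\<Sum>i<n. fst x, real n * snd x)"
  by (induction n) (auto simp: prod_eq_iff algebra_simps)

text \<open>Hahn-Banach over the integers: \<open>P\<close> acts as the epigraph of a subadditive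
  function that is nonnegative at 0, and \<open>neg\<close> makes the first projection of
  \<open>P\<close> a group. Constant sums stand for multiples of group elements by natural
  numbers.\<close>

lemma additive_minorant:
  fixes P :: "('v::ab_group_add \<times> real) set"
  assumes zero: "0 \<in> P"
    and add: "\<And>u v. u \<in> P \<Longrightarrow> v \<in> P \<Longrightarrow> u + v \<in> P"
    and neg: "\<And>v c. (v, c) \<in> P \<Longrightarrow> \<exists>c'. (- v, c') \<in> P"
    and nonneg: "\<And>c. (0, c) \<in> P \<Longrightarrow> 0 \<le> c"
  obtains L :: "'v \<Rightarrow> real"
  where "\<And>v c. (v, c) \<in> P \<Longrightarrow> L v \<le> c"
    and "\<And>u v. u \<in> fst ` P \<Longrightarrow> v \<in> fst ` P \<Longrightarrow> L (u + v) = L u + L v"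
proof -
  define S where "S = fst ` P"
  have S0: "0 \<in> S"
    using zero by (force simp: S_def)
  have Sadd: "u + v \<in> S" if uv: "u \<in> S" "v \<in> S" for u v
  proof -
    obtain p q where "p \<in> P" "q \<in> P" "u = fst p" "v = fst q"
      using uv by (auto simp: S_def)
    then show ?thesis
      using add[of p q] by (auto simp: S_def image_iff intro!: bexI[of _ "p + q"])
  qed
  have Sneg: "- v \<in> S" if "v \<in> S" for v
    using that neg by (force simp: S_def)
  \<comment> \<open>A maximal submonoid contains \<open>(v, r)\<close> or \<open>(- v, - r)\<close> for all \<open>v\<close> and \<open>r\<close>.\<close>
  define \<A> where "\<A> = {Q. P \<subseteq> Q \<and> fst ` Q \<subseteq> S \<and> (\<forall>u\<in>Q. \<forall>v\<in>Q. u + v \<in> Q) \<and> (\<forall>c. (0, c) \<in> Q \<longrightarrow> 0 \<le> c)}"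
  have "\<exists>M\<in>\<A>. \<forall>X\<in>\<A>. M \<subseteq> X \<longrightarrow> X = M"
  proof (rule subset_Zorn_nonempty)
    have "P \<in> \<A>"
      using add nonneg by (auto simp: \<A>_def S_def)
    then show "\<A> \<noteq> {}" by blast
  next
    fix \<C> assume \<C>: "\<C> \<noteq> {}" "subset.chain \<A> \<C>"
    then have sub: "\<C> \<subseteq> \<A>" and lin: "\<And>A B. A \<in> \<C> \<Longrightarrow> B \<in> \<C> \<Longrightarrow> A \<subseteq> B \<or> B \<subseteq> A"
      by (auto simp: subset_chain_def)
    have "u + v \<in> \<Union>\<C>" if uv: "u \<in> \<Union>\<C>" "v \<in> \<Union>\<C>" for u v
    proof -
      obtain A B where AB: "A \<in> \<C>" "u \<in> A" "B \<in> \<C>" "v \<in> B"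
        using uv by blast
      obtain D where "D \<in> \<C>" "u \<in> D" "v \<in> D"
        using lin[OF AB(1,3)] AB by blast
      then show ?thesis
        using sub by (auto simp: \<A>_def)
    qed
    moreover have "P \<subseteq> \<Union>\<C>"
      using sub \<C>(1) unfolding \<A>_def by blast
    moreover have "fst ` \<Union>\<C> \<subseteq> S"
      using sub unfolding \<A>_def by blast
    moreover have "\<forall>c. (0, c) \<in> \<Union>\<C> \<longrightarrow> 0 \<le> c"
      using sub unfolding \<A>_def by blast
    ultimately show "\<Union>\<C> \<in> \<A>"
      by (simp add: \<A>_def)
  qed
  then obtain M where M: "M \<in> \<A>" and max: "\<And>X. X \<in> \<A> \<Longrightarrow> M \<subseteq> X \<Longrightarrow> X = M"
    by blast
  have PM: "P \<subseteq> M" and MS: "\<And>m. m \<in> M \<Longrightarrow> fst m \<in> S"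
    and Madd: "\<And>u v. u \<in> M \<Longrightarrow> v \<in> M \<Longrightarrow> u + v \<in> M" and Mnonneg: "\<And>c. (0, c) \<in> M \<Longrightarrow> 0 \<le> c"
    using M by (auto simp: \<A>_def)
  have M0: "0 \<in> M" using PM zero by blast
  \<comment> \<open>By maximality, adjoining \<open>(v, r)\<close> must produce an element over 0
    with negative second entry; \<open>n\<close> counts the copies of \<open>(v, r)\<close> in
    it.\<close>
  have outside: "\<exists>(n::nat) c. (- (\<Sum>i<n. v), c) \<in> M \<and> c + real n * r < 0"
    if v: "v \<in> S" and notin: "(v, r) \<notin> M" for v r
  proof (rule ccontr)
    assume contr: "\<not> ?thesis"
    define Q where "Q = {m + (\<Sum>i<(n::nat). (v, r)) | m n. m \<in> M}"
    have MQ: "M \<subseteq> Q"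
    proof
      fix m assume "m \<in> M"
      then show "m \<in> Q"
        unfolding Q_def by (intro CollectI exI[of _ m] exI[of _ "0 :: nat"]) simp
    qed
    have "(v, r) \<in> Q"
      unfolding Q_def using M0 by (intro CollectI exI[of _ 0] exI[of _ "1 :: nat"]) simp
    have "Q \<in> \<A>"
      unfolding \<A>_def
    proof (intro CollectI conjI ballI allI impI)
      show "P \<subseteq> Q" using PM MQ by blast
      show "fst ` Q \<subseteq> S"
        using MS v sum_const_lessThan_mem[of S v] S0 Sadd
        by (auto simp: Q_def sum_const_lessThan_Pair)
      show "a + b \<in> Q" if ab: "a \<in> Q" "b \<in> Q" for a b
      proof -
        obtain m k :: "'v \<times> real" and n l :: nat
          where "m \<in> M" "k \<in> M" "a = m + (\<Sum>i<n. (v, r))" "b = k + (\<Sum>i<l. (v, r))"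
          using ab by (auto simp: Q_def)
        then have "a + b = (m + k) + (\<Sum>i<n + l. (v, r))" "m + k \<in> M"
          unfolding sum_const_lessThan_add[symmetric] by (simp_all add: Madd ac_simps)
        then show ?thesis
          unfolding Q_def by blast
      qed
      show "0 \<le> c" if c: "(0, c) \<in> Q" for c
      proof -
        obtain m :: "'v \<times> real" and n :: nat where m: "m \<in> M" "(0, c) = m + (\<Sum>i<n. (v, r))"
          using c unfolding Q_def by blast
        then have "fst m = - (\<Sum>i<n. v)" "c = snd m + real n * r"
          by (auto simp: sum_const_lessThan_Pair prod_eq_iff eq_neg_iff_add_eq_0)
        then have "(- (\<Sum>i<n. v), snd m) \<in> M" "c = snd m + real n * r"
          using m(1) by (metis prod.collapse)+
        then show ?thesis
          using contr by (auto simp: not_less)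
      qed
    qed
    then have "Q = M" using max MQ by blast
    then show False
      using \<open>(v, r) \<in> Q\<close> notin by blast
  qed
  have dich: "(v, r) \<in> M \<or> (- v, - r) \<in> M" if v: "v \<in> S" for v r
  proof (rule ccontr)
    assume contr: "\<not> ?thesis"
    obtain n :: nat and c where nc: "(- (\<Sum>i<n. v), c) \<in> M" "c + real n * r < 0"
      using outside[OF v, of r] contr by blast
    obtain m :: nat and c' where mc: "((\<Sum>i<m. v), c') \<in> M" "c' - real m * r < 0"
      using outside[OF Sneg[OF v], of "- r"] contr by (auto simp: sum_negf)
    \<comment> \<open>With \<open>m\<close> copies of the first witness and \<open>n\<close> of the
      second the group components cancel, so the second entry is nonnegative. In the sum of the two
      strict inequalities, weighted in the same way, the terms with \<open>r\<close> cancel: a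
      contradiction.\<close>
    have mem: "(\<Sum>i<m. (- (\<Sum>i<n. v), c)) + (\<Sum>i<n. ((\<Sum>i<m. v), c')) \<in> M"
      by (intro Madd sum_const_lessThan_mem M0 nc mc)
    have "(\<Sum>i<m. \<Sum>i<n. v) = (\<Sum>i<n. \<Sum>i<m. v)"
      by (rule sum.swap)
    then have "0 \<le> real m * c + real n * c'"
      using mem by (intro Mnonneg) (simp add: sum_const_lessThan_Pair sum_negf)
    moreover have "m > 0"
      using mc Mnonneg[of c'] by (cases m) auto
    moreover have "n > 0"
      using nc Mnonneg[of c] by (cases n) auto
    ultimately have "real m * (c + real n * r) < 0" "real n * (c' - real m * r) < 0"
      using nc(2) mc(2) by (simp_all add: mult_pos_neg)
    then have "real m * (c + real n * r) + real n * (c' - real m * r) < 0"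
      by (rule add_neg_neg)
    then show False
      using \<open>0 \<le> real m * c + real n * c'\<close> by (simp add: algebra_simps)
  qed
  define L where "L v = Inf {c. (v, c) \<in> M}" for v
  have ne: "{c. (v, c) \<in> M} \<noteq> {}" if "v \<in> S" for v
    using that PM by (force simp: S_def)
  have bdd: "bdd_below {c. (v, c) \<in> M}" if v: "v \<in> S" for v
  proof -
    obtain c' where c': "(- v, c') \<in> M"
      using ne[OF Sneg[OF v]] by blast
    have "- c' \<le> c" if "(v, c) \<in> M" for c
      using Mnonneg[of "c + c'"] Madd[OF that c'] by simp
    then show ?thesis
      by (auto intro!: bdd_belowI)
  qed
  have le: "L v \<le> c" if "(v, c) \<in> M" for v c
    unfolding L_def using that MS[OF that] bdd[of v] by (auto intro!: cInf_lower)
  have subadd: "L (u + v) \<le> L u + L v" if u: "u \<in> S" and v: "v \<in> S" for u v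
  proof -
    have "L (u + v) - c \<le> L v" if c: "(u, c) \<in> M" for c
      unfolding L_def[of v]
    proof (rule cInf_greatest[OF ne[OF v]])
      fix b assume "b \<in> {c. (v, c) \<in> M}"
      then show "L (u + v) - c \<le> b"
        using le[of "u + v" "c + b"] Madd[OF c, of "(v, b)"] by simp
    qed
    then have "L (u + v) - L v \<le> L u"
      unfolding L_def[of u] by (intro cInf_greatest[OF ne[OF u]]) (auto simp: algebra_simps)
    then show ?thesis by simp
  qed
  \<comment> \<open>A number \<open>r\<close> in the gap would leave both \<open>(v, - r)\<close>
    and \<open>(- v, r)\<close> outside \<open>M\<close>, against \<open>dich\<close>. This is what
    turns the subadditive \<open>L\<close> into an additive function.\<close>
  have negle: "L (- v) \<le> - L v" if v: "v \<in> S" for v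
  proof (rule ccontr)
    assume "\<not> ?thesis"
    then have "- L v < L (- v)"
      by simp
    then obtain r where r: "- L v < r" "r < L (- v)"
      using dense by blast
    then have "(v, - r) \<notin> M" "(- v, r) \<notin> M"
      using le[of v "- r"] le[of "- v" r] r by auto
    then show False
      using dich[OF v, of "- r"] by simp
  qed
  show ?thesis
  proof
    show "L v \<le> c" if "(v, c) \<in> P" for v c
      using that PM le by blast
    show "L (u + v) = L u + L v" if "u \<in> fst ` P" "v \<in> fst ` P" for u v
    proof (rule antisym)
      have u: "u \<in> S" and v: "v \<in> S" using that by (auto simp: S_def)
      show "L (u + v) \<le> L u + L v" by (rule subadd[OF u v])
      have "L (u + v + - v) \<le> L (u + v) + L (- v)"
        by (intro subadd Sadd Sneg u v)
      then show "L u + L v \<le> L (u + v)"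
        using negle[OF v] by simp
    qed
  qed
qed

subsection \<open>Duality for matchings\<close>

text \<open>An additive functional of the marginal defects that lies below the excess cost
  \<open>C s - \<epsilon> * size w\<close> is evaluated on single pairs, where it splits as
  \<open>u i a + v i b\<close>. The bound \<open>\<epsilon>\<close> reappears on the diagonal pairs
  \<open>(g, g)\<close>.\<close>

lemma transport_duality:
  fixes c :: "'i \<Rightarrow> 'a \<Rightarrow> 'a \<Rightarrow> real" and \<epsilon> :: real
  assumes fin: "finite I"
    and cost: "\<And>w s. (\<And>i. i \<in> I \<Longrightarrow> image_mset fst (s i) = w \<and> image_mset snd (s i) = w) \<Longrightarrow>
      \<epsilon> * real (size w) \<le> (\<Sum>i\<in>I. \<Sum>p\<in>#s i. c i (fst p) (snd p))"
  obtains u v :: "'i \<Rightarrow> 'a \<Rightarrow> real"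
  where "\<And>i a b. i \<in> I \<Longrightarrow> u i a + v i b \<le> c i a b"
    and "\<And>g. \<epsilon> \<le> (\<Sum>i\<in>I. u i g + v i g)"
proof -
  define C where "C s = (\<Sum>i\<in>I. \<Sum>p\<in>#s i. c i (fst p) (snd p))" for s
  \<comment> \<open>\<open>V s w\<close> records by how much the marginals of the matchings \<open>s i\<close> fail to be \<open>w\<close>.\<close>
  define V :: "('i \<Rightarrow> ('a \<times> 'a) multiset) \<Rightarrow> 'a multiset \<Rightarrow> 'i \<times> bool \<times> 'a \<Rightarrow> int"
    where "V s w = (\<lambda>(i, k, x). if i \<in> I then
      int (count (image_mset (if k then fst else snd) (s i)) x) - int (count w x) else 0)" for s w
  \<comment> \<open>Over defect 0 the fibre condition of \<open>additive_minorant\<close> is exactly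
    the hypothesis \<open>cost\<close>.\<close>
  define P where "P = {(V s w, r) | s w r. C s - \<epsilon> * real (size w) \<le> r}"
  have V_add: "V s w + V s' w' = V (\<lambda>i. s i + s' i) (w + w')" for s s' w w'
    by (auto simp: V_def fun_eq_iff)
  have C_add: "C (\<lambda>i. s i + s' i) = C s + C s'" for s s'
    by (simp add: C_def sum.distrib)
  have V_0: "V (\<lambda>_. {#}) {#} = 0"
    by (auto simp: V_def fun_eq_iff)
  have PI: "(V s w, r) \<in> P" if "C s - \<epsilon> * real (size w) \<le> r" for s w r
    using that by (auto simp: P_def)
  have "0 \<in> P"
    using PI[of "\<lambda>_. {#}" "{#}" 0] by (simp add: C_def V_0 zero_prod_def)
  have P_add: "p + q \<in> P" if pq: "p \<in> P" "q \<in> P" for p q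
  proof -
    obtain s w r where p: "p = (V s w, r)" "C s - \<epsilon> * real (size w) \<le> r"
      using pq(1) by (auto simp: P_def)
    obtain s' w' r' where q: "q = (V s' w', r')" "C s' - \<epsilon> * real (size w') \<le> r'"
      using pq(2) by (auto simp: P_def)
    have "(V (\<lambda>i. s i + s' i) (w + w'), r + r') \<in> P"
      by (rule PI) (use p(2) q(2) in \<open>simp add: C_add algebra_simps\<close>)
    then show ?thesis
      by (simp add: p q V_add)
  qed
  have P_neg: "\<exists>r'. (- x, r') \<in> P" if x: "(x, r) \<in> P" for x r
  proof -
    obtain s w where x: "x = V s w"
      using x by (auto simp: P_def)
    \<comment> \<open>Swapping the pairs exchanges the two marginals, and diagonal pairs fill both
      up, so that for \<open>i\<close> in \<open>I\<close> both marginals of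
      \<open>s i + s' i\<close> equal \<open>w + w'\<close>. As \<open>w'\<close> dominates each
      such \<open>m i\<close>, the multiset difference truncates nothing.\<close>
    define m where "m i = image_mset fst (s i) + image_mset snd (s i)" for i
    define w' where "w' = sum m I"
    define s' where "s' i = image_mset (\<lambda>a. (a, a)) (w + (w' - m i)) + image_mset prod.swap (s i)" for i
    have le: "count (m i) y \<le> count w' y" if "i \<in> I" for i y
      using that fin unfolding w'_def count_sum
      by (intro member_le_sum[of i I "\<lambda>i. count (m i) y"]) auto
    have fst': "image_mset fst (s' i) = w + (w' - m i) + image_mset snd (s i)"
      and snd': "image_mset snd (s' i) = w + (w' - m i) + image_mset fst (s i)" for i
      by (simp_all add: s'_def multiset.map_comp comp_def del: image_mset_union)
         (simp_all add: multiset.map_comp comp_def)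
    have "V s w + V s' w' = 0"
    proof
      fix t :: "'i \<times> bool \<times> 'a"
      obtain i k y where t: "t = (i, k, y)" by (cases t)
      show "(V s w + V s' w') t = 0 t"
        using le[of i y] by (cases k) (auto simp: V_def t fst' snd' m_def)
    qed
    then have "- x = V s' w'"
      by (simp add: x minus_unique)
    then show ?thesis
      using PI[OF order_refl, of s' w'] by auto
  qed
  have P_nonneg: "0 \<le> r" if r: "(0, r) \<in> P" for r
  proof -
    obtain s w where V: "V s w = 0" and r: "C s - \<epsilon> * real (size w) \<le> r"
      using r by (auto simp: P_def)
    have cnt: "V s w (i, k, y) = 0" for i k y
      by (simp add: V)
    have "image_mset fst (s i) = w \<and> image_mset snd (s i) = w" if "i \<in> I" for i
      using cnt[of i True] cnt[of i False] that by (auto simp: V_def intro!: multiset_eqI)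
    then have "\<epsilon> * real (size w) \<le> C s"
      unfolding C_def by (intro cost) auto
    then show ?thesis
      using r by simp
  qed
  obtain L where L_le: "\<And>x r. (x, r) \<in> P \<Longrightarrow> L x \<le> r"
    and L_add: "\<And>x y. x \<in> fst ` P \<Longrightarrow> y \<in> fst ` P \<Longrightarrow> L (x + y) = L x + L y"
    by (rule additive_minorant[OF \<open>0 \<in> P\<close> P_add P_neg P_nonneg]) blast+
  have V_mem: "V s w \<in> fst ` P" for s w
    using PI[OF order_refl, of s w] by (force simp: image_iff)
  have LV_add: "L (V (\<lambda>i. s i + s' i) (w + w')) = L (V s w) + L (V s' w')" for s s' w w'
    using L_add[OF V_mem V_mem, of s w s' w'] by (simp add: V_add)
  define E where "E i p = (\<lambda>j. if j = i then {#p#} else {#})" for i :: 'i and p :: "'a \<times> 'a"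
  define l where "l i a b = L (V (E i (a, b)) {#})" for i a b
  have "C (E i (a, b)) = c i a b" if "i \<in> I" for i a b
  proof -
    have "C (E i (a, b)) = (\<Sum>j\<in>I. if j = i then c i a b else 0)"
      unfolding C_def by (intro sum.cong) (auto simp: E_def)
    then show ?thesis
      using fin that by simp
  qed
  then have l_le: "l i a b \<le> c i a b" if "i \<in> I" for i a b
    unfolding l_def using that by (intro L_le PI) simp
  \<comment> \<open>Both sides come from pairs with the same marginals, hence with the same defect.
    This is what lets \<open>l i\<close> split into a function of \<open>a\<close> plus a function
    of \<open>b\<close>.\<close>
  have l_exchange: "l i a b + l i a' b' = l i a b' + l i a' b" for i a b a' b'
  proof -
    have "V (E i (a, b)) {#} + V (E i (a', b')) {#} = V (E i (a, b')) {#} + V (E i (a', b)) {#}"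
      by (auto simp: V_def E_def fun_eq_iff)
    then show ?thesis
      unfolding l_def by (metis L_add V_mem)
  qed
  have L0: "L 0 = 0"
    using L_add[OF V_mem V_mem, of "\<lambda>_. {#}" "{#}" "\<lambda>_. {#}" "{#}"] unfolding V_0 by simp
  have diag: "L (V (\<lambda>i. if i \<in> J then {#(g, g)#} else {#}) {#}) = (\<Sum>i\<in>J. l i g g)"
    if "finite J" for J g
    using that
  proof (induction J)
    case empty
    show ?case by (simp only: V_0 L0 empty_iff if_False sum.empty)
  next
    case (insert j J)
    have "(\<lambda>i. if i \<in> insert j J then {#(g, g)#} else {#})
        = (\<lambda>i. E j (g, g) i + (if i \<in> J then {#(g, g)#} else {#}))"
      using insert.hyps by (auto simp: E_def fun_eq_iff)
    then have "L (V (\<lambda>i. if i \<in> insert j J then {#(g, g)#} else {#}) {#})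
        = l j g g + L (V (\<lambda>i. if i \<in> J then {#(g, g)#} else {#}) {#})"
      using LV_add[of "E j (g, g)" "\<lambda>i. if i \<in> J then {#(g, g)#} else {#}" "{#}" "{#}"]
      by (simp add: l_def)
    then show ?case
      using insert by simp
  qed
  \<comment> \<open>Taking \<open>(g, g)\<close> for every \<open>i\<close> in \<open>I\<close>
    against \<open>w = {#g#}\<close> has defect 0, while \<open>w = {#g#}\<close> with empty
    matchings contributes at most \<open>- \<epsilon>\<close>.\<close>
  have l_ge: "\<epsilon> \<le> (\<Sum>i\<in>I. l i g g)" for g
  proof -
    have "V (\<lambda>i. if i \<in> I then {#(g, g)#} else {#}) {#g#} = 0"
      by (auto simp: V_def fun_eq_iff)
    then have "0 = (\<Sum>i\<in>I. l i g g) + L (V (\<lambda>_. {#}) {#g#})"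
      using LV_add[of "\<lambda>i. if i \<in> I then {#(g, g)#} else {#}" "\<lambda>_. {#}" "{#}" "{#g#}"]
      by (simp add: diag[OF fin] L0)
    moreover have "L (V (\<lambda>_. {#}) {#g#}) \<le> - \<epsilon>"
      by (intro L_le PI) (simp add: C_def)
    ultimately show ?thesis by simp
  qed
  show ?thesis
  proof
    fix i a b assume "i \<in> I"
    \<comment> \<open>\<open>undefined\<close> serves as an arbitrary base point for the
      splitting.\<close>
    show "l i a undefined + (l i undefined b - l i undefined undefined) \<le> c i a b"
      using l_le[OF \<open>i \<in> I\<close>, of a b] l_exchange[of i a undefined undefined b] by simp
  next
    fix g
    have "l i g undefined + (l i undefined g - l i undefined undefined) = l i g g" for i
      using l_exchange[of i g undefined undefined g] by simp
    then show "\<epsilon> \<le> (\<Sum>i\<in>I. l i g undefined + (l i undefined g - l i undefined undefined))"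
      using l_ge[of g] by simp
  qed
qed

text \<open>An infimum of 1-Lipschitz functions \<open>d (a + y) x - u a\<close> of \<open>x\<close>
  is 1-Lipschitz, as in Kantorovich-Rubinstein duality. Taking \<open>a = g\<close> gives
  \<open>F (g + y) \<le> - u g\<close>, and \<open>le\<close> gives both boundedness from below and
  \<open>v g \<le> F (g + z)\<close>.\<close>

lemma lipschitz_potential:
  fixes d :: "'a::group_add \<Rightarrow> 'a \<Rightarrow> real"
  assumes d: "Metric_space UNIV d"
    and le: "\<And>a b. u a + v b \<le> d (a + y) (b + z)"
  obtains F :: "'a \<Rightarrow> real"
  where "\<And>x x'. F x - F x' \<le> d x x'" and "\<And>g. u g + v g \<le> F (g + z) - F (g + y)"
proof -
  interpret Metric_space UNIV d by (rule d)
  define F where "F x = (INF a. d (a + y) x - u a)" for x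
  have lower: "v (x - z) \<le> d (a + y) x - u a" for a x
    using le[of a "x - z"] by simp
  have bdd: "bdd_below (range (\<lambda>a. d (a + y) x - u a))" for x
    using lower by (auto intro!: bdd_belowI2)
  have F_le: "F x \<le> d (a + y) x - u a" for x a
    unfolding F_def by (rule cINF_lower[OF bdd]) simp
  have F_ge: "v (x - z) \<le> F x" for x
    unfolding F_def by (rule cINF_greatest) (use lower in auto)
  show ?thesis
  proof
    fix x x'
    have "F x - d x x' \<le> F x'"
      unfolding F_def[of x']
    proof (rule cINF_greatest)
      fix a
      have "d (a + y) x \<le> d (a + y) x' + d x' x"
        by (intro triangle) auto
      then show "F x - d x x' \<le> d (a + y) x' - u a"
        using F_le[of x a] commute[of x x'] by simp
    qed simp
    then show "F x - F x' \<le> d x x'" by simp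
  next
    fix g
    show "u g + v g \<le> F (g + z) - F (g + y)"
      using F_le[of "g + y" g] F_ge[of "g + z"] by simp
  qed
qed

subsection \<open>The fixed point argument\<close>

lemma compatible_metric_continuous:
  fixes d :: "'a::topological_space \<Rightarrow> 'a \<Rightarrow> real"
  assumes d: "compatible_metric d" and f: "(f \<longlongrightarrow> a) F" and g: "(g \<longlongrightarrow> b) F"
  shows "((\<lambda>x. d (f x) (g x)) \<longlongrightarrow> d a b) F"
proof -
  interpret Metric_space UNIV d
    using d by (simp add: compatible_metric_def)
  have top: "mtopology = euclidean"
    using d by (simp add: compatible_metric_def)
  have ev: "\<forall>\<^sub>F x in F. d c (h x) < e" if "e > 0" and h: "(h \<longlongrightarrow> c) F" for c h e
  proof -
    have "open (mball c e)"
      using openin_mball[of c e] by (simp add: top)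
    then have "\<forall>\<^sub>F x in F. h x \<in> mball c e"
      using h \<open>e > 0\<close> by (intro topological_tendstoD) auto
    then show ?thesis
      by (auto elim: eventually_mono)
  qed
  show ?thesis
  proof (rule tendstoI)
    fix e :: real assume "e > 0"
    then have "\<forall>\<^sub>F x in F. d a (f x) < e / 2 \<and> d b (g x) < e / 2"
      by (intro eventually_conj ev f g) auto
    then show "\<forall>\<^sub>F x in F. dist (d (f x) (g x)) (d a b) < e"
    proof (rule eventually_mono)
      fix x assume x: "d a (f x) < e / 2 \<and> d b (g x) < e / 2"
      have "d (f x) (g x) \<le> d (f x) a + d a (g x)" "d a (g x) \<le> d a b + d b (g x)"
        "d a b \<le> d a (f x) + d (f x) b" "d (f x) b \<le> d (f x) (g x) + d (g x) b"
        by (intro triangle; simp)+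
      then show "dist (d (f x) (g x)) (d a b) < e"
        using x commute[of "f x" a] commute[of "g x" b] unfolding dist_real_def by linarith
    qed
  qed
qed

section \<open>Real functions with the product topology as a locally convex space\<close>

definition function_module :: "(real, 'b \<Rightarrow> real) module" where
  "function_module = \<lparr>carrier = UNIV, mult = undefined, one = undefined, zero = \<lambda>_. 0,
     add = \<lambda>f g x. f x + g x, smult = \<lambda>c f x. c * f x\<rparr>"

lemma function_module_simps [simp]:
  "carrier function_module = UNIV"
  "\<zero>\<^bsub>function_module\<^esub> = (\<lambda>_. 0)"
  "f \<oplus>\<^bsub>function_module\<^esub> g = (\<lambda>x. f x + g x)"
  "c \<odot>\<^bsub>function_module\<^esub> f = (\<lambda>x. c * f x)"
  by (simp_all add: function_module_def)

lemma module_function_module: "module real_ring (function_module :: (real, 'b \<Rightarrow> real) module)"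
proof (rule moduleI[OF cring_real_ring])
  have "\<exists>g. (\<lambda>x. g x + f x) = (\<lambda>_. 0)" for f :: "'b \<Rightarrow> real"
    by (rule exI[of _ "\<lambda>x. - f x"]) simp
  then show "abelian_group (function_module :: (real, 'b \<Rightarrow> real) module)"
    by (intro abelian_groupI) (auto simp: algebra_simps)
qed (auto simp: real_ring_def algebra_simps)

lemma locally_convex_function_module:
  "locally_convex_tvs (function_module :: (real, 'b \<Rightarrow> real) module) euclidean"
  unfolding locally_convex_tvs_def
proof (intro conjI allI impI)
  show "module real_ring (function_module :: (real, 'b \<Rightarrow> real) module)"
    by (rule module_function_module)
  show "topspace (euclidean :: ('b \<Rightarrow> real) topology) = carrier function_module"
    by simp
  show "Hausdorff_space (euclidean :: ('b \<Rightarrow> real) topology)"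
    unfolding euclidean_product_topology[symmetric] Hausdorff_space_product_topology
    by simp
  have fst_coord: "continuous_on UNIV (\<lambda>p :: ('b \<Rightarrow> real) \<times> ('b \<Rightarrow> real). fst p k)" for k
    by (rule continuous_on_product_then_coordinatewise[OF continuous_on_fst[OF continuous_on_id]])
  have snd_coord: "continuous_on UNIV (\<lambda>p :: 'c::topological_space \<times> ('b \<Rightarrow> real). snd p k)" for k
    by (rule continuous_on_product_then_coordinatewise[OF continuous_on_snd[OF continuous_on_id]])
  have "continuous_on UNIV (\<lambda>p :: ('b \<Rightarrow> real) \<times> ('b \<Rightarrow> real). \<lambda>x. fst p x + snd p x)"
    by (intro continuous_on_coordinatewise_then_product continuous_on_add fst_coord snd_coord)
  then show "continuous_map (prod_topology euclidean euclidean) euclidean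
      (\<lambda>(f, g). f \<oplus>\<^bsub>function_module :: (real, 'b \<Rightarrow> real) module\<^esub> g)"
    by (simp add: case_prod_unfold)
  have "continuous_on UNIV (\<lambda>p :: real \<times> ('b \<Rightarrow> real). \<lambda>x. fst p * snd p x)"
    by (intro continuous_on_coordinatewise_then_product continuous_on_mult snd_coord
        continuous_on_fst[OF continuous_on_id])
  then show "continuous_map (prod_topology euclideanreal euclidean) euclidean
      (\<lambda>(a, g). a \<odot>\<^bsub>function_module :: (real, 'b \<Rightarrow> real) module\<^esub> g)"
    by (simp add: case_prod_unfold)
  fix U :: "('b \<Rightarrow> real) set"
  assume U: "openin euclidean U \<and> \<zero>\<^bsub>function_module\<^esub> \<in> U"
  then have "openin (product_topology (\<lambda>_. euclideanreal) UNIV) U" "(\<lambda>_. 0) \<in> U"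
    by (simp_all add: euclidean_product_topology)
  then obtain X where X: "(\<lambda>_. 0) \<in> (\<Pi>\<^sub>E i\<in>UNIV. X i)" "\<And>i. open (X i)"
      "finite {i. X i \<noteq> UNIV}" "(\<Pi>\<^sub>E i\<in>UNIV. X i) \<subseteq> U"
    using product_topology_open_contains_basis[of "\<lambda>_. euclideanreal" UNIV U "\<lambda>_. 0"] by auto
  have "\<exists>r>0. ball 0 r \<subseteq> X i" for i
    using X(1) X(2)[of i] by (meson PiE_mem UNIV_I open_contains_ball)
  then obtain r where r: "\<And>i. r i > 0" "\<And>i. ball 0 (r i) \<subseteq> X i"
    by metis
  \<comment> \<open>A convex replacement for \<open>X\<close>. Factors equal to \<open>UNIV\<close>
    are kept whole, so that only finitely many coordinates are restricted and the product stays
    open.\<close>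
  define B where "B i = (if X i = UNIV then UNIV else ball (0 :: real) (r i))" for i
  have convB: "convex (B i)" for i
    by (simp add: B_def)
  show "\<exists>W. openin euclidean W \<and> \<zero>\<^bsub>function_module\<^esub> \<in> W \<and> W \<subseteq> U \<and> convex_in function_module W"
  proof (intro exI conjI)
    have "{i. B i \<noteq> UNIV} \<subseteq> {i. X i \<noteq> UNIV}"
      by (auto simp: B_def)
    then have "open (Pi\<^sub>E UNIV B)"
      using X(3) by (intro open_PiE) (auto simp: B_def intro: finite_subset)
    then show "openin euclidean (Pi\<^sub>E UNIV B)"
      by simp
    show "\<zero>\<^bsub>function_module\<^esub> \<in> Pi\<^sub>E UNIV B"
      using r by (auto simp: B_def)
    have "Pi\<^sub>E UNIV B \<subseteq> Pi\<^sub>E UNIV X"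
      by (rule PiE_mono) (use r(2) in \<open>auto simp: B_def\<close>)
    then show "Pi\<^sub>E UNIV B \<subseteq> U"
      using X(4) by blast
    show "convex_in function_module (Pi\<^sub>E UNIV B)"
      unfolding convex_in_def
    proof (intro conjI ballI)
      fix f g :: "'b \<Rightarrow> real" and t :: real
      assume fg: "f \<in> Pi\<^sub>E UNIV B" "g \<in> Pi\<^sub>E UNIV B" and t: "t \<in> {0..1}"
      have "(1 - t) * f i + t * g i \<in> B i" for i
      proof -
        have "f i \<in> B i" "g i \<in> B i"
          using fg by auto
        then show ?thesis
          using convexD_alt[OF convB[of i], of "f i" "g i" t] t by simp
      qed
      then show "((1 - t) \<odot>\<^bsub>function_module\<^esub> f) \<oplus>\<^bsub>function_module\<^esub> (t \<odot>\<^bsub>function_module\<^esub> g) \<in> Pi\<^sub>E UNIV B"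
        by (simp add: PiE_iff)
    qed simp
  qed
qed

text \<open>
  Families indexed by pairs of points live in the universe \<open>('a \<Rightarrow> real) \<Rightarrow> real\<close> of the definition
  of amenability once their arguments are encoded as functions; the weights 1, 2, 4 make the
  code injective.
\<close>

definition point_code :: "('a \<times> 'a) \<times> 'a \<Rightarrow> 'a \<Rightarrow> real" where
  "point_code = (\<lambda>((y, z), x) t. of_bool (t = y) + 2 * of_bool (t = z) + 4 * of_bool (t = x))"

lemma inj_point_code: "inj point_code"
proof (rule injI)
  fix p q :: "('a \<times> 'a) \<times> 'a"
  assume pq: "point_code p = point_code q"
  obtain y z x where p: "p = ((y, z), x)" by (cases p) auto
  obtain y' z' x' where q: "q = ((y', z'), x')" by (cases q) auto
  have eq: "point_code ((y, z), x) = point_code ((y', z'), x')"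
    using pq by (simp only: p q)
  have at: "(of_bool (t = y) + 2 * of_bool (t = z) + 4 * of_bool (t = x) :: real)
      = of_bool (t = y') + 2 * of_bool (t = z') + 4 * of_bool (t = x')" for t
    using fun_cong[OF eq, of t] by (simp add: point_code_def)
  have bits: "(t = y \<longleftrightarrow> t = y') \<and> (t = z \<longleftrightarrow> t = z') \<and> (t = x \<longleftrightarrow> t = x')" for t
    using at[of t]
    by (auto simp: of_bool_def split: if_splits)
  show "p = q"
    using bits[of y] bits[of z] bits[of x] by (simp add: p q)
qed

text \<open>Subtracting constants changes none of the differences in \<open>lip\<close> and
  \<open>ge\<close>, so the functions may be normalised to vanish at 0. The fixed point still
  satisfies the inequality \<open>ge\<close>, whose right-hand side is 0 once its components are
  trivial homomorphisms.\<close>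

lemma amenable_potentials_le_0:
  fixes d :: "'a::topological_group_add \<Rightarrow> 'a \<Rightarrow> real" and \<epsilon> :: real
    and F :: "'a \<times> 'a \<Rightarrow> 'a \<Rightarrow> real"
  assumes am: "amenable TYPE('a)" and comp: "compatible_metric d" and linv: "left_invariant_metric d"
    and hom: "no_nontrivial_real_hom TYPE('a)"
    and lip: "\<And>i x x'. F i x - F i x' \<le> d x x'"
    and ge: "\<And>g. \<epsilon> \<le> (\<Sum>i\<in>I. F i (g + snd i) - F i (g + fst i))"
  shows "\<epsilon> \<le> 0"
proof -
  interpret Metric_space UNIV d
    using comp by (simp add: compatible_metric_def)
  have d_left: "d (g + x) (g + y) = d x y" for g x y
    using linv by (simp add: left_invariant_metric_def)
  define e where "e i x = point_code (i, x)" for i :: "'a \<times> 'a" and x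
  define \<pi> where "\<pi> = (inv_into UNIV point_code :: ('a \<Rightarrow> real) \<Rightarrow> ('a \<times> 'a) \<times> 'a)"
  have \<pi>_e [simp]: "\<pi> (e i x) = (i, x)" for i x
    by (simp add: \<pi>_def e_def inj_point_code)
  define R where "R = range (point_code :: ('a \<times> 'a) \<times> 'a \<Rightarrow> _)"
  have e_R [simp]: "e i x \<in> R" for i x
    by (simp add: R_def e_def)
  have R_cases: "\<exists>i x. \<theta> = e i x" if "\<theta> \<in> R" for \<theta>
    using that by (auto simp: R_def e_def)
  \<comment> \<open>\<open>D\<close> vanishes outside \<open>R\<close> and at the codes of 0, so the
    single bound \<open>\<bar>\<kappa> \<theta>\<bar> \<le> D \<theta>\<close> places
    \<open>K\<close> in a compact box, encodes the normalisation, and makes the coordinates that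
    encode nothing vanish.\<close>
  define D where "D \<theta> = (if \<theta> \<in> R then d (snd (\<pi> \<theta>)) 0 else 0)" for \<theta>
  have D_e [simp]: "D (e i x) = d x 0" for i x
    by (simp add: D_def)
  define K where "K = {\<kappa> :: ('a \<Rightarrow> real) \<Rightarrow> real. (\<forall>\<theta>. \<bar>\<kappa> \<theta>\<bar> \<le> D \<theta>) \<and>
      (\<forall>i x x'. \<kappa> (e i x) - \<kappa> (e i x') \<le> d x x') \<and>
      (\<forall>g. \<epsilon> \<le> (\<Sum>i\<in>I. \<kappa> (e i (g + snd i)) - \<kappa> (e i (g + fst i))))}"
  have K_bound: "\<bar>\<kappa> \<theta>\<bar> \<le> D \<theta>" and K_lip: "\<kappa> (e i x) - \<kappa> (e i x') \<le> d x x'"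
    and K_ge: "\<epsilon> \<le> (\<Sum>i\<in>I. \<kappa> (e i (g + snd i)) - \<kappa> (e i (g + fst i)))"
    if "\<kappa> \<in> K" for \<kappa> \<theta> i x x' g
    using that unfolding K_def by blast+
  have K_0: "\<kappa> (e i 0) = 0" and K_out: "\<theta> \<notin> R \<Longrightarrow> \<kappa> \<theta> = 0" if "\<kappa> \<in> K" for \<kappa> i \<theta>
    using K_bound[OF that, of "e i 0"] K_bound[OF that, of \<theta>] by (simp_all add: D_def)
  have K_lip_abs: "\<bar>\<kappa> (e i x) - \<kappa> (e i x')\<bar> \<le> d x x'" if "\<kappa> \<in> K" for \<kappa> i x x'
    using K_lip[OF that, of i x x'] K_lip[OF that, of i x' x] commute[of x x'] by linarith
  \<comment> \<open>left translation, normalised to vanish at the identity\<close>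
  define \<alpha> where "\<alpha> g \<kappa> = (\<lambda>\<theta>. if \<theta> \<in> R then
      \<kappa> (e (fst (\<pi> \<theta>)) (- g + snd (\<pi> \<theta>))) - \<kappa> (e (fst (\<pi> \<theta>)) (- g)) else 0)"
    for g :: 'a and \<kappa> :: "('a \<Rightarrow> real) \<Rightarrow> real"
  have \<alpha>_e [simp]: "\<alpha> g \<kappa> (e i x) = \<kappa> (e i (- g + x)) - \<kappa> (e i (- g))" for g \<kappa> i x
    by (simp add: \<alpha>_def)
  have \<alpha>_out [simp]: "\<theta> \<notin> R \<Longrightarrow> \<alpha> g \<kappa> \<theta> = 0" for g \<kappa> \<theta>
    by (simp add: \<alpha>_def)
  have ext_R: "\<kappa> = \<kappa>'" if "\<And>i x. \<kappa> (e i x) = \<kappa>' (e i x)" "\<And>\<theta>. \<theta> \<notin> R \<Longrightarrow> \<kappa> \<theta> = \<kappa>' \<theta>"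
    for \<kappa> \<kappa>' :: "('a \<Rightarrow> real) \<Rightarrow> real"
  proof
    fix \<theta>
    show "\<kappa> \<theta> = \<kappa>' \<theta>"
      using that R_cases[of \<theta>] by (cases "\<theta> \<in> R") auto
  qed
  have coord: "continuous_on UNIV (\<lambda>\<kappa> :: ('a \<Rightarrow> real) \<Rightarrow> real. \<kappa> \<theta>)" for \<theta>
    by simp
  have "K \<noteq> {}"
  proof -
    define \<kappa> where "\<kappa> = (\<lambda>\<theta>. if \<theta> \<in> R then F (fst (\<pi> \<theta>)) (snd (\<pi> \<theta>)) - F (fst (\<pi> \<theta>)) 0 else 0)"
    have e: "\<kappa> (e i x) = F i x - F i 0" for i x
      by (simp add: \<kappa>_def)
    have "\<bar>\<kappa> \<theta>\<bar> \<le> D \<theta>" for \<theta>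
    proof (cases "\<theta> \<in> R")
      case True
      then obtain i x where "\<theta> = e i x"
        using R_cases by blast
      then show ?thesis
        using lip[of i x 0] lip[of i 0 x] commute[of x 0] by (simp add: e)
    qed (simp add: \<kappa>_def D_def)
    then have "\<kappa> \<in> K"
      using lip ge by (simp add: K_def e)
    then show ?thesis by blast
  qed
  have "compactin euclidean K"
  proof -
    have "compactin (product_topology (\<lambda>_. euclideanreal) UNIV) (\<Pi>\<^sub>E \<theta>\<in>UNIV. {- D \<theta>..D \<theta>})"
      by (simp add: compactin_PiE)
    then have "compact (\<Pi>\<^sub>E \<theta>\<in>UNIV. {- D \<theta>..D \<theta>})"
      by (simp add: euclidean_product_topology)
    moreover have "closed {\<kappa> :: ('a \<Rightarrow> real) \<Rightarrow> real. (\<forall>i x x'. \<kappa> (e i x) - \<kappa> (e i x') \<le> d x x') \<and>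
        (\<forall>g. \<epsilon> \<le> (\<Sum>i\<in>I. \<kappa> (e i (g + snd i)) - \<kappa> (e i (g + fst i))))}"
      by (intro closed_Collect_conj closed_Collect_all closed_Collect_le continuous_on_const
          continuous_on_sum continuous_on_diff coord)
    moreover have "K = (\<Pi>\<^sub>E \<theta>\<in>UNIV. {- D \<theta>..D \<theta>}) \<inter>
        {\<kappa>. (\<forall>i x x'. \<kappa> (e i x) - \<kappa> (e i x') \<le> d x x') \<and>
        (\<forall>g. \<epsilon> \<le> (\<Sum>i\<in>I. \<kappa> (e i (g + snd i)) - \<kappa> (e i (g + fst i))))}"
      by (auto simp: K_def abs_le_iff PiE_iff minus_le_iff)
    ultimately show ?thesis
      by (simp add: compact_Int_closed)
  qed
  have "convex_in function_module K"
    unfolding convex_in_def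
  proof (intro conjI ballI)
    fix \<kappa> \<kappa>' and t :: real assume \<kappa>: "\<kappa> \<in> K" "\<kappa>' \<in> K" and t: "t \<in> {0..1}"
    have *: "(1 - t) * a + t * b \<le> c" if "a \<le> c" "b \<le> c" for a b c :: real
      using convex_bound_le[of a c b "1 - t" t] that t by simp
    have "(\<lambda>\<theta>. (1 - t) * \<kappa> \<theta> + t * \<kappa>' \<theta>) \<in> K"
      unfolding K_def
    proof (intro CollectI conjI allI)
      fix \<theta>
      show "\<bar>(1 - t) * \<kappa> \<theta> + t * \<kappa>' \<theta>\<bar> \<le> D \<theta>"
        using *[of "\<kappa> \<theta>" "D \<theta>" "\<kappa>' \<theta>"] *[of "- \<kappa> \<theta>" "D \<theta>" "- \<kappa>' \<theta>"]
          K_bound[OF \<kappa>(1), of \<theta>] K_bound[OF \<kappa>(2), of \<theta>] by (simp add: abs_le_iff)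
    next
      fix i x x'
      show "(1 - t) * \<kappa> (e i x) + t * \<kappa>' (e i x) - ((1 - t) * \<kappa> (e i x') + t * \<kappa>' (e i x')) \<le> d x x'"
        using *[OF K_lip[OF \<kappa>(1)] K_lip[OF \<kappa>(2)], of i x x' i] by (simp add: algebra_simps)
    next
      fix g
      define S where "S \<kappa> = (\<Sum>i\<in>I. \<kappa> (e i (g + snd i)) - \<kappa> (e i (g + fst i)))"
        for \<kappa> :: "('a \<Rightarrow> real) \<Rightarrow> real"
      have "S (\<lambda>\<theta>. (1 - t) * \<kappa> \<theta> + t * \<kappa>' \<theta>) = (1 - t) * S \<kappa> + t * S \<kappa>'"
        unfolding S_def by (simp add: sum_distrib_left sum.distrib[symmetric] algebra_simps)
      then show "\<epsilon> \<le> (\<Sum>i\<in>I. (1 - t) * \<kappa> (e i (g + snd i)) + t * \<kappa>' (e i (g + snd i)) -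
          ((1 - t) * \<kappa> (e i (g + fst i)) + t * \<kappa>' (e i (g + fst i))))"
        using *[of "- S \<kappa>" "- \<epsilon>" "- S \<kappa>'"] K_ge[OF \<kappa>(1), of g] K_ge[OF \<kappa>(2), of g]
        by (simp add: S_def)
    qed
    then show "((1 - t) \<odot>\<^bsub>function_module\<^esub> \<kappa>) \<oplus>\<^bsub>function_module\<^esub> (t \<odot>\<^bsub>function_module\<^esub> \<kappa>') \<in> K"
      by simp
  qed simp
  have \<alpha>_K: "\<alpha> g \<kappa> \<in> K" if \<kappa>: "\<kappa> \<in> K" for g \<kappa>
    unfolding K_def
  proof (intro CollectI conjI allI)
    fix \<theta>
    show "\<bar>\<alpha> g \<kappa> \<theta>\<bar> \<le> D \<theta>"
    proof (cases "\<theta> \<in> R")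
      case True
      then obtain i x where "\<theta> = e i x"
        using R_cases by blast
      then show ?thesis
        using K_lip_abs[OF \<kappa>, of i "- g + x" "- g + 0"] by (simp add: d_left del: add_0_right) simp
    qed (simp add: D_def)
  next
    fix i x x'
    show "\<alpha> g \<kappa> (e i x) - \<alpha> g \<kappa> (e i x') \<le> d x x'"
      using K_lip[OF \<kappa>, of i "- g + x" "- g + x'"] by (simp add: d_left)
  next
    fix h
    \<comment> \<open>The normalising constants cancel, and associativity leaves the inequality for
      \<open>\<kappa>\<close> at the point \<open>- g + h\<close>.\<close>
    show "\<epsilon> \<le> (\<Sum>i\<in>I. \<alpha> g \<kappa> (e i (h + snd i)) - \<alpha> g \<kappa> (e i (h + fst i)))"
      using K_ge[OF \<kappa>, of "- g + h"] by (simp add: add.assoc)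
  qed
  \<comment> \<open>Joint continuity: the Lipschitz bound, uniform over \<open>K\<close>, replaces
    the moving group element by \<open>g\<close> at a cost measured by \<open>d\<close>; what
    remains is evaluation at one fixed coordinate.\<close>
  have cont: "continuous_on (UNIV \<times> K) (\<lambda>p. snd p (e i (- fst p + x)))" for i x
    unfolding continuous_on_def
  proof
    fix p assume p: "p \<in> (UNIV :: 'a set) \<times> K"
    obtain g \<kappa> where p_eq: "p = (g, \<kappa>)" by (cases p)
    let ?F = "at p within UNIV \<times> K"
    have "((\<lambda>q. - fst q + x) \<longlongrightarrow> - fst p + x) ?F"
      by (intro tendsto_intros)
    then have "((\<lambda>q. d (- fst q + x) (- g + x)) \<longlongrightarrow> d (- g + x) (- g + x)) ?F"
      by (intro compatible_metric_continuous[OF comp] tendsto_const) (simp add: p_eq)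
    moreover have "((\<lambda>q. snd q (e i (- g + x))) \<longlongrightarrow> \<kappa> (e i (- g + x))) ?F"
      using continuous_on_product_then_coordinatewise[OF continuous_on_snd[OF continuous_on_id], of "UNIV \<times> K" "e i (- g + x)"] p
      by (auto simp: continuous_on_def p_eq)
    ultimately have "((\<lambda>q. d (- fst q + x) (- g + x) + \<bar>snd q (e i (- g + x)) - \<kappa> (e i (- g + x))\<bar>)
        \<longlongrightarrow> d (- g + x) (- g + x) + \<bar>\<kappa> (e i (- g + x)) - \<kappa> (e i (- g + x))\<bar>) ?F"
      by (intro tendsto_intros)
    then have lim: "((\<lambda>q. d (- fst q + x) (- g + x) + \<bar>snd q (e i (- g + x)) - \<kappa> (e i (- g + x))\<bar>)
        \<longlongrightarrow> 0) ?F"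
      by simp
    have "\<forall>\<^sub>F q in ?F. norm (snd q (e i (- fst q + x)) - \<kappa> (e i (- g + x)))
        \<le> d (- fst q + x) (- g + x) + \<bar>snd q (e i (- g + x)) - \<kappa> (e i (- g + x))\<bar>"
      unfolding eventually_at_filter
    proof (intro always_eventually allI impI)
      fix q assume "q \<in> (UNIV :: 'a set) \<times> K"
      then show "norm (snd q (e i (- fst q + x)) - \<kappa> (e i (- g + x)))
        \<le> d (- fst q + x) (- g + x) + \<bar>snd q (e i (- g + x)) - \<kappa> (e i (- g + x))\<bar>"
        using K_lip_abs[of "snd q" i "- fst q + x" "- g + x"] by (auto simp: mem_Times_iff)
    qed
    then have "((\<lambda>q. snd q (e i (- fst q + x)) - \<kappa> (e i (- g + x))) \<longlongrightarrow> 0) ?F"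
      by (rule Lim_null_comparison[OF _ lim])
    then show "((\<lambda>q. snd q (e i (- fst q + x))) \<longlongrightarrow> snd p (e i (- fst p + x))) ?F"
      by (simp add: p_eq LIM_zero_iff)
  qed
  have cont_\<alpha>: "continuous_on (UNIV \<times> K) (\<lambda>p. \<alpha> (fst p) (snd p))"
  proof (rule continuous_on_coordinatewise_then_product)
    fix \<theta>
    show "continuous_on (UNIV \<times> K) (\<lambda>p. \<alpha> (fst p) (snd p) \<theta>)"
    proof (cases "\<theta> \<in> R")
      case True
      then obtain i x where "\<theta> = e i x"
        using R_cases by blast
      then show ?thesis
        using continuous_on_diff[OF cont[of i x] cont[of i 0]] by simp
    qed (simp add: continuous_on_const)
  qed
  have "continuous_affine_action function_module euclidean K \<alpha>"
    unfolding continuous_affine_action_def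
  proof (intro conjI allI ballI)
    show "\<alpha> g \<kappa> \<in> K" if "\<kappa> \<in> K" for g \<kappa>
      using that by (rule \<alpha>_K)
    show "\<alpha> 0 \<kappa> = \<kappa>" if "\<kappa> \<in> K" for \<kappa>
      using K_0[OF that] K_out[OF that] by (intro ext_R) simp_all
    show "\<alpha> (g + h) \<kappa> = \<alpha> g (\<alpha> h \<kappa>)" if "\<kappa> \<in> K" for g h \<kappa>
    proof (rule ext_R)
      fix i x
      show "\<alpha> (g + h) \<kappa> (e i x) = \<alpha> g (\<alpha> h \<kappa>) (e i x)"
        by (simp only: \<alpha>_e minus_add add.assoc)
    qed simp
    show "\<alpha> g (((1 - t) \<odot>\<^bsub>function_module\<^esub> \<kappa>) \<oplus>\<^bsub>function_module\<^esub> (t \<odot>\<^bsub>function_module\<^esub> \<kappa>')) =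
        ((1 - t) \<odot>\<^bsub>function_module\<^esub> \<alpha> g \<kappa>) \<oplus>\<^bsub>function_module\<^esub> (t \<odot>\<^bsub>function_module\<^esub> \<alpha> g \<kappa>')"
      for g \<kappa> \<kappa>' and t :: real
      by (intro ext_R) (simp_all add: algebra_simps)
    have "prod_topology euclidean (subtopology euclidean K)
        = subtopology euclidean ((UNIV :: 'a set) \<times> K)"
      using prod_topology_subtopology_eu[of "UNIV :: 'a set" K] by simp
    then show "continuous_map (prod_topology euclidean (subtopology euclidean K))
        (subtopology euclidean K) (\<lambda>(g, \<kappa>). \<alpha> g \<kappa>)"
      using cont_\<alpha> \<alpha>_K
      by (auto simp: continuous_map_in_subtopology case_prod_unfold)
  qed
  then obtain \<kappa> where \<kappa>: "\<kappa> \<in> K" and fixed: "\<And>g. \<alpha> g \<kappa> = \<kappa>"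
    using am \<open>K \<noteq> {}\<close> \<open>compactin euclidean K\<close> \<open>convex_in function_module K\<close>
      locally_convex_function_module
    unfolding amenable_def affine_fixed_point_property_def by metis
  have zero: "\<kappa> (e i x) = 0" for i x
  proof -
    \<comment> \<open>For the group element \<open>- y\<close> the fixed point equation is
      additivity.\<close>
    have "\<kappa> (e i (y + x)) = \<kappa> (e i y) + \<kappa> (e i x)" for x y
      using \<alpha>_e[of "- y" \<kappa> i x] by (simp add: fixed)
    moreover have "continuous_on UNIV (\<lambda>x. \<kappa> (e i x))"
      unfolding continuous_on_def
    proof
      fix x
      have "((\<lambda>y. d y x) \<longlongrightarrow> d x x) (at x)"
        by (intro compatible_metric_continuous[OF comp] tendsto_intros)
      then have lim: "((\<lambda>y. d y x) \<longlongrightarrow> 0) (at x)"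
        by simp
      have "\<forall>\<^sub>F y in at x. norm (\<kappa> (e i y) - \<kappa> (e i x)) \<le> d y x"
        unfolding real_norm_def by (intro always_eventually allI K_lip_abs[OF \<kappa>])
      then have "((\<lambda>y. \<kappa> (e i y) - \<kappa> (e i x)) \<longlongrightarrow> 0) (at x)"
        by (rule Lim_null_comparison[OF _ lim])
      then show "((\<lambda>y. \<kappa> (e i y)) \<longlongrightarrow> \<kappa> (e i x)) (at x)"
        by (simp add: LIM_zero_iff)
    qed
    ultimately show ?thesis
      using hom unfolding no_nontrivial_real_hom_def by blast
  qed
  show ?thesis
    using K_ge[OF \<kappa>, of 0] by (simp only: zero) simp
qed

text \<open>If the total cost were always at least \<open>\<epsilon> * size w\<close>, duality
  followed by \<open>lipschitz_potential\<close> would yield functions excluded by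
  \<open>amenable_potentials_le_0\<close>. As costs are nonnegative, the strict inequality rules out
  the empty \<open>w\<close> and bounds each single cost.\<close>

lemma amenable_approximate_transport:
  fixes d :: "'a::topological_group_add \<Rightarrow> 'a \<Rightarrow> real" and \<epsilon> :: real
    and I :: "('a \<times> 'a) set"
  assumes am: "amenable TYPE('a)" and comp: "compatible_metric d" and linv: "left_invariant_metric d"
    and hom: "no_nontrivial_real_hom TYPE('a)"
    and fin: "finite I" and \<epsilon>: "\<epsilon> > 0"
  obtains w s where "w \<noteq> {#}"
    and "\<And>i. i \<in> I \<Longrightarrow> image_mset fst (s i) = w \<and> image_mset snd (s i) = w"
    and "\<And>i. i \<in> I \<Longrightarrow> (\<Sum>p\<in>#s i. d (fst p + fst i) (snd p + snd i)) < \<epsilon> * real (size w)"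
proof -
  interpret Metric_space UNIV d
    using comp by (simp add: compatible_metric_def)
  let ?c = "\<lambda>i a b. d (a + fst i) (b + snd i)"
  have "\<exists>w s. (\<forall>i\<in>I. image_mset fst (s i) = w \<and> image_mset snd (s i) = w) \<and>
      (\<Sum>i\<in>I. \<Sum>p\<in>#s i. ?c i (fst p) (snd p)) < \<epsilon> * real (size w)"
  proof (rule ccontr)
    assume contr: "\<not> ?thesis"
    have cost: "\<epsilon> * real (size w) \<le> (\<Sum>i\<in>I. \<Sum>p\<in>#s i. ?c i (fst p) (snd p))"
      if "\<And>i. i \<in> I \<Longrightarrow> image_mset fst (s i) = w \<and> image_mset snd (s i) = w" for w s
    proof (rule ccontr)
      assume "\<not> ?thesis"
      then show False
        using contr that unfolding not_le by blast
    qed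
    obtain u v where uv: "\<And>i a b. i \<in> I \<Longrightarrow> u i a + v i b \<le> ?c i a b"
      and ge: "\<And>g. \<epsilon> \<le> (\<Sum>i\<in>I. u i g + v i g)"
      by (rule transport_duality[of I \<epsilon> ?c, OF fin cost]) blast+
    have "\<exists>F. (\<forall>x x'. F x - F x' \<le> d x x') \<and>
        (i \<in> I \<longrightarrow> (\<forall>g. u i g + v i g \<le> F (g + snd i) - F (g + fst i)))" for i
    proof (cases "i \<in> I")
      case True
      show ?thesis
        by (rule lipschitz_potential[OF Metric_space_axioms uv[OF True]]) blast
    next
      \<comment> \<open>\<open>amenable_potentials_le_0\<close> asks for Lipschitz functions at all
        indices; the zero function fills the places outside \<open>I\<close>.\<close>
      case False
      then show ?thesis by (intro exI[of _ "\<lambda>_. 0"]) simp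
    qed
    then obtain F where F: "\<And>i x x'. F i x - F i x' \<le> d x x'"
      "\<And>i g. i \<in> I \<Longrightarrow> u i g + v i g \<le> F i (g + snd i) - F i (g + fst i)"
      by metis
    have "\<epsilon> \<le> (\<Sum>i\<in>I. F i (g + snd i) - F i (g + fst i))" for g
      using ge[of g] sum_mono[of I "\<lambda>i. u i g + v i g" "\<lambda>i. F i (g + snd i) - F i (g + fst i)"] F(2)
      by fastforce
    then have "\<epsilon> \<le> 0"
      by (rule amenable_potentials_le_0[OF am comp linv hom F(1)])
    then show False using \<epsilon> by simp
  qed
  then obtain w s where ws: "\<And>i. i \<in> I \<Longrightarrow> image_mset fst (s i) = w \<and> image_mset snd (s i) = w"
    and lt: "(\<Sum>i\<in>I. \<Sum>p\<in>#s i. ?c i (fst p) (snd p)) < \<epsilon> * real (size w)"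
    by blast
  have nonneg: "0 \<le> (\<Sum>p\<in>#s i. ?c i (fst p) (snd p))" for i
  proof -
    have "0 \<le> (\<Sum>p\<in>#M. ?c i (fst p) (snd p))" for M
      by (induction M) auto
    then show ?thesis .
  qed
  show ?thesis
  proof
    have "0 \<le> (\<Sum>i\<in>I. \<Sum>p\<in>#s i. ?c i (fst p) (snd p))"
      by (intro sum_nonneg nonneg)
    then show "w \<noteq> {#}"
      using lt by auto
    show "image_mset fst (s i) = w \<and> image_mset snd (s i) = w" if "i \<in> I" for i
      using that by (rule ws)
    show "(\<Sum>p\<in>#s i. d (fst p + fst i) (snd p + snd i)) < \<epsilon> * real (size w)" if "i \<in> I" for i
      using member_le_sum[OF that, of "\<lambda>i. \<Sum>p\<in>#s i. ?c i (fst p) (snd p)"] nonneg fin lt by simp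
  qed
qed

subsection \<open>Uniqueness and unimodularity of Haar measure\<close>

text \<open>Multiples turn boundedness into smallness: if the \<open>n\<close>-fold multiple of
  \<open>x - a\<close> lies in a symmetric neighbourhood where
  \<open>\<bar>\<rho>\<bar> \<le> M\<close>, then
  \<open>n * \<bar>\<rho> x - \<rho> a\<bar> \<le> M\<close>. Intersecting \<open>W\<close> with its
  inverse makes the one-sided bound two-sided.\<close>

lemma additive_bounded_above_imp_continuous:
  fixes \<rho> :: "'a::topological_group_add \<Rightarrow> real"
  assumes add: "\<And>x y. \<rho> (x + y) = \<rho> x + \<rho> y"
    and W: "open W" "0 \<in> W" and le: "\<And>x. x \<in> W \<Longrightarrow> \<rho> x \<le> M"
  shows "continuous_on UNIV \<rho>"
proof -
  have \<rho>_0: "\<rho> 0 = 0"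
    using add[of 0 0] by simp
  have \<rho>_minus: "\<rho> (- x) = - \<rho> x" for x
    using add[of "- x" x] by (simp add: \<rho>_0)
  define W' where "W' = W \<inter> uminus -` W"
  have cont_minus: "continuous_on UNIV (uminus :: 'a \<Rightarrow> 'a)"
    unfolding continuous_on_def by (intro ballI tendsto_intros)
  have "open W'"
    unfolding W'_def using W(1) open_vimage[OF W(1) cont_minus] by blast
  have "0 \<in> W'"
    using W(2) by (simp add: W'_def)
  have le': "\<bar>\<rho> x\<bar> \<le> M" if "x \<in> W'" for x
    using that le[of x] le[of "- x"] by (simp add: W'_def \<rho>_minus)
  \<comment> \<open>\<open>p n x\<close> is the \<open>n\<close>-fold multiple of \<open>x\<close>,
    a power in multiplicative notation.\<close>
  define p where "p n x = (((+) x) ^^ n) 0" for n and x :: 'a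
  have \<rho>_p: "\<rho> (p n x) = real n * \<rho> x" for n x
    by (induction n) (simp_all add: p_def \<rho>_0 add algebra_simps)
  have cont_p: "continuous_on UNIV (p n)" for n
  proof (induction n)
    case 0
    then show ?case by (simp add: p_def)
  next
    case (Suc n)
    have "continuous_on UNIV (\<lambda>x. x + p n x)"
      by (intro continuous_on_add continuous_on_id Suc)
    moreover have "p (Suc n) = (\<lambda>x. x + p n x)"
      by (simp add: p_def fun_eq_iff)
    ultimately show ?case by simp
  qed
  have p_0: "p n 0 = 0" for n
    by (induction n) (simp_all add: p_def)
  show ?thesis
    unfolding continuous_on_def
  proof (intro ballI tendstoI)
    fix a and e :: real assume "e > 0"
    obtain n :: nat where n: "real n * e > M"
      using \<open>e > 0\<close> ex_less_of_nat_mult by blast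
    have "continuous_on UNIV (\<lambda>x. p n (x - a))"
      by (rule continuous_on_compose2[OF cont_p[of n]])
        (auto simp: continuous_on_def diff_conv_add_uminus simp del: add_uminus_conv_diff intro!: tendsto_intros)
    then have "open ((\<lambda>x. p n (x - a)) -` W')"
      by (rule open_vimage[OF \<open>open W'\<close>])
    moreover have "a \<in> (\<lambda>x. p n (x - a)) -` W'"
      using \<open>0 \<in> W'\<close> by (simp add: p_0)
    ultimately have "\<forall>\<^sub>F x in at a. x \<in> (\<lambda>x. p n (x - a)) -` W'"
      by (rule eventually_at_in_open')
    then show "\<forall>\<^sub>F x in at a. dist (\<rho> x) (\<rho> a) < e"
    proof (rule eventually_mono)
      fix x assume "x \<in> (\<lambda>x. p n (x - a)) -` W'"
      then have "\<bar>real n * \<rho> (x - a)\<bar> \<le> M"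
        using le'[of "p n (x - a)"] by (simp add: \<rho>_p)
      then have "real n * \<bar>\<rho> (x - a)\<bar> < real n * e"
        using n by (simp add: abs_mult)
      then have "\<bar>\<rho> (x - a)\<bar> < e"
        by (rule mult_left_less_imp_less) simp
      moreover have "\<rho> x = \<rho> (x - a) + \<rho> a"
        using add[of "x - a" a] by simp
      ultimately show "dist (\<rho> x) (\<rho> a) < e"
        by (simp add: dist_real_def)
    qed
  qed
qed

lemma borel_measurable_group_uminus [measurable]:
  "(uminus :: 'a::topological_group_add \<Rightarrow> 'a) \<in> borel_measurable borel"
  by (rule borel_measurable_continuous_onI) (auto simp: continuous_on_def intro!: tendsto_intros)

section \<open>Haar measure: sigma-finiteness, open sets, null sets and translations\<close>

locale Haar_space =
  fixes \<mu> :: "'a::{topological_group_add, t2_space, second_countable_topology} measure"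
  assumes lc: "locally_compact_space (euclidean :: 'a topology)"
    and Haar: "left_Haar_measure \<mu>"
begin

lemma sets_\<mu> [measurable_cong, simp]: "sets \<mu> = sets borel"
  using Haar by (simp add: left_Haar_measure_def)

lemma space_\<mu> [simp]: "space \<mu> = UNIV"
  using sets_eq_imp_space_eq[OF sets_\<mu>] by simp

lemma emeasure_compact: "compact K \<Longrightarrow> emeasure \<mu> K < \<infinity>"
  using Haar by (simp add: left_Haar_measure_def)

lemma compact_neighbourhood:
  obtains U K where "open U" "x \<in> U" "compact K" "U \<subseteq> (K :: 'a set)"
proof -
  have "\<exists>U K. open U \<and> compact K \<and> x \<in> U \<and> U \<subseteq> K"
    using lc by (simp add: locally_compact_space_def)
  then show thesis
    using that by blast
qed

lemma distr_left_translate: "distr \<mu> borel (\<lambda>x. g + x) = \<mu>"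
proof (rule measure_eqI)
  fix A assume "A \<in> sets (distr \<mu> borel (\<lambda>x. g + x))"
  then have A: "A \<in> sets borel" by simp
  have "(\<lambda>x. g + x) -` A = (\<lambda>x. - g + x) ` A"
    by (force simp: image_iff add.assoc[symmetric])
  moreover have "emeasure \<mu> ((\<lambda>x. - g + x) ` A) = emeasure \<mu> A"
    using Haar A unfolding left_Haar_measure_def by blast
  ultimately show "emeasure (distr \<mu> borel (\<lambda>x. g + x)) A = emeasure \<mu> A"
    using A by (simp add: emeasure_distr)
qed simp

lemma nn_integral_left_translate:
  assumes "f \<in> borel_measurable borel"
  shows "(\<integral>\<^sup>+x. f (g + x) \<partial>\<mu>) = (\<integral>\<^sup>+x. f x \<partial>\<mu>)"
proof -
  have "(\<integral>\<^sup>+x. f x \<partial>\<mu>) = (\<integral>\<^sup>+x. f x \<partial>distr \<mu> borel (\<lambda>x. g + x))"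
    by (simp add: distr_left_translate)
  also have "\<dots> = (\<integral>\<^sup>+x. f (g + x) \<partial>\<mu>)"
    using assms by (intro nn_integral_distr) simp_all
  finally show ?thesis by simp
qed

text \<open>Lindelof's theorem for the open sets of finite measure; the sigma-finiteness obtained
  from it underlies Fubini and Radon-Nikodym below.\<close>

lemma countable_open_cover_finite_measure:
  obtains \<U> :: "'a set set" where "countable \<U>" "\<Union>\<U> = UNIV"
    "\<And>U. U \<in> \<U> \<Longrightarrow> open U" "\<And>U. U \<in> \<U> \<Longrightarrow> emeasure \<mu> U \<noteq> \<infinity>"
proof -
  define \<F> where "\<F> = {U :: 'a set. open U \<and> emeasure \<mu> U < \<infinity>}"
  have \<F>: "\<Union>\<F> = UNIV"
  proof -
    have "x \<in> \<Union>\<F>" for x :: 'a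
    proof -
      obtain U K where UK: "open U" "x \<in> U" "compact K" "U \<subseteq> K"
        by (rule compact_neighbourhood)
      then have "emeasure \<mu> U \<le> emeasure \<mu> K"
        by (intro emeasure_mono) (auto intro: borel_compact)
      then show ?thesis
        using UK emeasure_compact[of K] by (auto simp: \<F>_def)
    qed
    then show ?thesis by blast
  qed
  obtain \<U> where \<U>: "\<U> \<subseteq> \<F>" "countable \<U>" "\<Union>\<U> = \<Union>\<F>"
    using Lindelof_openin[of \<F> UNIV] by (auto simp: \<F>_def)
  show ?thesis
  proof (rule that[of \<U>])
    show "countable \<U>" "\<Union>\<U> = UNIV"
      using \<U> \<F> by auto
    show "open U" "emeasure \<mu> U \<noteq> \<infinity>" if "U \<in> \<U>" for U
      using that \<U>(1) by (auto simp: \<F>_def)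
  qed
qed

sublocale \<mu>: sigma_finite_measure \<mu>
proof
  obtain \<U> :: "'a set set" where U: "countable \<U>" "\<Union>\<U> = UNIV"
    "\<And>U. U \<in> \<U> \<Longrightarrow> open U" "\<And>U. U \<in> \<U> \<Longrightarrow> emeasure \<mu> U \<noteq> \<infinity>"
    by (rule countable_open_cover_finite_measure) blast
  then show "\<exists>A. countable A \<and> A \<subseteq> sets \<mu> \<and> \<Union>A = space \<mu> \<and> (\<forall>a\<in>A. emeasure \<mu> a \<noteq> \<infinity>)"
    by (intro exI[of _ \<U>]) auto
qed

sublocale \<mu>\<mu>: pair_sigma_finite \<mu> \<mu> ..

text \<open>The left translates of \<open>U\<close> cover the group and countably many of them
  suffice; if they were null, the whole measure would vanish.\<close>

lemma emeasure_open_pos: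
  assumes U: "open U" "U \<noteq> {}"
  shows "emeasure \<mu> U > 0"
proof (rule ccontr)
  assume "\<not> ?thesis"
  then have U0: "emeasure \<mu> U = 0" by simp
  obtain u where u: "u \<in> U" using U by blast
  have openg: "open ((\<lambda>x. g + x) -` U)" for g
    using U(1) by (intro open_vimage) (auto simp: continuous_on_def intro!: tendsto_intros)
  have null: "emeasure \<mu> ((\<lambda>x. g + x) -` U) = 0" for g
  proof -
    have "emeasure \<mu> U = emeasure (distr \<mu> borel (\<lambda>x. g + x)) U"
      by (simp only: distr_left_translate)
    then show ?thesis
      using U U0 by (simp add: emeasure_distr)
  qed
  have "\<Union>(range (\<lambda>g. (\<lambda>x. g + x) -` U)) = UNIV"
  proof -
    have "x \<in> (\<lambda>y. (u - x) + y) -` U" for x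
      using u by simp
    then show ?thesis by blast
  qed
  moreover obtain \<U> where \<U>: "\<U> \<subseteq> range (\<lambda>g. (\<lambda>x. g + x) -` U)" "countable \<U>"
    "\<Union>\<U> = \<Union>(range (\<lambda>g. (\<lambda>x. g + x) -` U))"
    using Lindelof_openin[of "range (\<lambda>g. (\<lambda>x. g + x) -` U)" UNIV] openg by auto
  moreover have "(\<Union>A\<in>\<U>. A) \<in> null_sets \<mu>"
    using \<U> openg null by (intro null_sets_UN') (auto intro!: null_setsI)
  ultimately have "emeasure \<mu> UNIV = 0"
    by (auto dest: null_setsD1)
  then show False
    using Haar by (simp add: left_Haar_measure_def)
qed

text \<open>Allows a point to be picked from an almost everywhere statement.\<close>

lemma not_AE_False: "\<not> (AE x in \<mu>. False)"
  using emeasure_open_pos[of UNIV] by (simp add: AE_iff_measurable[of UNIV])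

lemma AE_left_translate:
  assumes "Measurable.pred borel P"
  shows "(AE x in \<mu>. P (g + x)) \<longleftrightarrow> (AE x in \<mu>. P x)"
proof -
  have "(AE x in distr \<mu> borel (\<lambda>x. g + x). P x) \<longleftrightarrow> (AE x in \<mu>. P (g + x))"
    using assms by (intro AE_distr_iff) (simp_all add: pred_def)
  then show ?thesis
    by (simp only: distr_left_translate)
qed

text \<open>For each \<open>y\<close>, left invariance gives \<open>P (- y + x)\<close> for almost
  all \<open>x\<close>. Fubini then provides a single \<open>x\<close> for which it holds for almost
  all \<open>y\<close>.\<close>

lemma AE_uminus:
  assumes [measurable]: "Measurable.pred borel P" and ae: "AE x in \<mu>. P x"
  shows "AE x in \<mu>. P (- x)"
proof -
  have "AE y in \<mu>. AE x in \<mu>. P (- y + x)"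
    using ae AE_left_translate[of P] by simp
  then have "AE x in \<mu>. AE y in \<mu>. P (- y + x)"
    by (subst (asm) \<mu>\<mu>.AE_commute) measurable
  then obtain x where x: "AE y in \<mu>. P (- y + x)"
    using not_AE_False by (metis (mono_tags, lifting) eventually_mono)
  \<comment> \<open>The left translation of \<open>y\<close> by \<open>x\<close> turns
    \<open>- y + x\<close> into \<open>- y\<close>.\<close>
  have "AE y in \<mu>. P (- (x + y) + x)"
    by (subst AE_left_translate[of "\<lambda>y. P (- y + x)"]) (use x in measurable)
  then show ?thesis
    by (simp add: minus_add)
qed

text \<open>Inversion conjugates left translation into right translation:
  \<open>- (- g + y) = - y + g\<close>.\<close>

lemma AE_right_translate:
  assumes [measurable]: "Measurable.pred borel P" and ae: "AE x in \<mu>. P x"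
  shows "AE x in \<mu>. P (x + g)"
proof -
  have "AE y in \<mu>. P (- (- g + y))"
    by (subst AE_left_translate[of "\<lambda>y. P (- y)"]) (use AE_uminus[OF assms] in measurable)
  then have "AE y in \<mu>. P (- y + g)"
    by (simp add: minus_add)
  then have "AE y in \<mu>. P (- (- y) + g)"
    by (intro AE_uminus[of "\<lambda>y. P (- y + g)"]) measurable
  then show ?thesis by simp
qed

text \<open>The factor \<open>c\<close> is the value of the modular function at \<open>g\<close>, up
  to inversion. The right-translated measure is absolutely continuous by
  \<open>AE_right_translate\<close>, so that it can be studied through its Radon-Nikodym
  density.\<close>

lemma right_translate_multiple:
  obtains c where "\<And>f. f \<in> borel_measurable borel \<Longrightarrow>
    (\<integral>\<^sup>+x. f (x + g) \<partial>\<mu>) = c * (\<integral>\<^sup>+x. f x \<partial>\<mu>)"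
proof -
  define \<nu> where "\<nu> = distr \<mu> borel (\<lambda>x. x + g)"
  have sets_\<nu> [simp]: "sets \<nu> = sets borel"
    by (simp add: \<nu>_def)
  \<comment> \<open>The density of \<open>\<nu>\<close> is invariant under left translations, hence constant by Fubini.\<close>
  have "absolutely_continuous \<mu> \<nu>"
    unfolding absolutely_continuous_def
  proof
    fix N assume N: "N \<in> null_sets \<mu>"
    then have N_sets [measurable]: "N \<in> sets borel" by auto
    have "AE x in \<mu>. x \<notin> N"
      using N by (rule AE_not_in)
    then have "AE x in \<mu>. x + g \<notin> N"
      by (intro AE_right_translate) measurable
    then have "AE x in \<nu>. x \<notin> N"
      unfolding \<nu>_def by (subst AE_distr_iff) simp_all
    then show "N \<in> null_sets \<nu>"
      using N_sets by (simp add: AE_iff_null_sets)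
  qed
  then obtain \<phi> where \<phi>: "\<phi> \<in> borel_measurable \<mu>" "density \<mu> \<phi> = \<nu>"
    using \<mu>.Radon_Nikodym[of \<nu>] by auto
  have [measurable]: "\<phi> \<in> borel_measurable borel"
    using \<phi>(1) by (simp cong: measurable_cong_sets)
  have \<nu>_int: "(\<integral>\<^sup>+x. f (x + g) \<partial>\<mu>) = (\<integral>\<^sup>+x. \<phi> x * f x \<partial>\<mu>)"
    if [measurable]: "f \<in> borel_measurable borel" for f
  proof -
    have "(\<integral>\<^sup>+x. f (x + g) \<partial>\<mu>) = (\<integral>\<^sup>+x. f x \<partial>\<nu>)"
      unfolding \<nu>_def by (simp add: nn_integral_distr)
    also have "\<dots> = (\<integral>\<^sup>+x. \<phi> x * f x \<partial>\<mu>)"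
      unfolding \<phi>(2)[symmetric] by (intro nn_integral_density) measurable
    finally show ?thesis .
  qed
  \<comment> \<open>Left and right translations commute, so \<open>\<nu>\<close> is left invariant
    like \<open>\<mu>\<close>; uniqueness of densities transfers this to
    \<open>\<phi>\<close>.\<close>
  have "AE x in \<mu>. \<phi> (h + x) = \<phi> x" for h
  proof (rule \<mu>.density_unique)
    show "density \<mu> (\<lambda>x. \<phi> (h + x)) = density \<mu> \<phi>"
    proof (rule measure_eqI)
      fix A assume "A \<in> sets (density \<mu> (\<lambda>x. \<phi> (h + x)))"
      then have A [measurable]: "A \<in> sets borel" by simp
      have "emeasure (density \<mu> (\<lambda>x. \<phi> (h + x))) A = (\<integral>\<^sup>+x. \<phi> (h + x) * indicator A x \<partial>\<mu>)"
        by (simp add: emeasure_density)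
      also have "\<dots> = (\<integral>\<^sup>+x. \<phi> (h + x) * indicator A (- h + (h + x)) \<partial>\<mu>)"
        by (simp add: add.assoc[symmetric])
      also have "\<dots> = (\<integral>\<^sup>+x. \<phi> x * indicator A (- h + x) \<partial>\<mu>)"
        by (rule nn_integral_left_translate[of "\<lambda>x. \<phi> x * indicator A (- h + x)"]) measurable
      also have "\<dots> = (\<integral>\<^sup>+x. indicator A (- h + (x + g)) \<partial>\<mu>)"
        by (rule \<nu>_int[symmetric, of "\<lambda>x. indicator A (- h + x)"]) measurable
      also have "\<dots> = (\<integral>\<^sup>+x. indicator A ((- h + x) + g) \<partial>\<mu>)"
        by (simp add: add.assoc)
      also have "\<dots> = (\<integral>\<^sup>+x. indicator A (x + g) \<partial>\<mu>)"
        by (rule nn_integral_left_translate[of "\<lambda>x. indicator A (x + g)"]) measurable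
      also have "\<dots> = (\<integral>\<^sup>+x. \<phi> x * indicator A x \<partial>\<mu>)"
        by (rule \<nu>_int) measurable
      also have "\<dots> = emeasure (density \<mu> \<phi>) A"
        by (simp add: emeasure_density)
      finally show "emeasure (density \<mu> (\<lambda>x. \<phi> (h + x))) A = emeasure (density \<mu> \<phi>) A" .
    qed simp
  qed measurable
  then have "AE h in \<mu>. AE x in \<mu>. \<phi> (h + x) = \<phi> x"
    by simp
  then have "AE x in \<mu>. AE h in \<mu>. \<phi> (h + x) = \<phi> x"
    by (subst (asm) \<mu>\<mu>.AE_commute) measurable
  then obtain x where x: "AE h in \<mu>. \<phi> (h + x) = \<phi> x"
    using not_AE_False by (metis (mono_tags, lifting) eventually_mono)
  \<comment> \<open>Replacing \<open>h\<close> by \<open>h - x\<close> preserves null sets and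
    exhibits \<open>\<phi> x\<close> as the constant.\<close>
  have "AE h in \<mu>. \<phi> (h + - x + x) = \<phi> x"
    by (rule AE_right_translate[of "\<lambda>h. \<phi> (h + x) = \<phi> x"]) (use x in measurable)
  then have const: "AE h in \<mu>. \<phi> h = \<phi> x"
    by simp
  show ?thesis
  proof
    fix f :: "'a \<Rightarrow> ennreal" assume f [measurable]: "f \<in> borel_measurable borel"
    have "(\<integral>\<^sup>+x. f (x + g) \<partial>\<mu>) = (\<integral>\<^sup>+y. \<phi> y * f y \<partial>\<mu>)"
      by (rule \<nu>_int[OF f])
    also have "\<dots> = (\<integral>\<^sup>+y. \<phi> x * f y \<partial>\<mu>)"
      by (intro nn_integral_cong_AE) (use const in eventually_elim, simp)
    also have "\<dots> = \<phi> x * (\<integral>\<^sup>+x. f x \<partial>\<mu>)"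
      by (intro nn_integral_cmult) measurable
    finally show "(\<integral>\<^sup>+x. f (x + g) \<partial>\<mu>) = \<phi> x * (\<integral>\<^sup>+x. f x \<partial>\<mu>)" .
  qed
qed

end

section \<open>Unimodularity\<close>

context Haar_space
begin

lemma open_right_translate: "open U \<Longrightarrow> open {x. x + g \<in> U}" for U :: "'a set"
proof -
  assume "open U"
  moreover have "continuous_on UNIV (\<lambda>x. x + g)"
    by (intro continuous_on_add continuous_on_id continuous_on_const)
  ultimately have "open ((\<lambda>x. x + g) -` U)"
    by (rule open_vimage)
  then show ?thesis
    by (simp add: vimage_def)
qed

text \<open>The factors \<open>c g\<close> are multiplicative in \<open>g\<close>, positive and
  finite, so their logarithm is a homomorphism to the reals. An upper bound near the identity makes
  it continuous, and \<open>hom\<close> makes it vanish.\<close>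

lemma nn_integral_right_translate:
  assumes hom: "no_nontrivial_real_hom TYPE('a)"
    and f: "f \<in> borel_measurable borel"
  shows "(\<integral>\<^sup>+x. f (x + g) \<partial>\<mu>) = (\<integral>\<^sup>+x. f x \<partial>\<mu>)"
proof -
  have "\<exists>c. \<forall>f\<in>borel_measurable borel. (\<integral>\<^sup>+x. f (x + g) \<partial>\<mu>) = c * (\<integral>\<^sup>+x. f x \<partial>\<mu>)" for g
    using right_translate_multiple[of g] by metis
  then obtain c where c: "\<And>g f. f \<in> borel_measurable borel \<Longrightarrow>
      (\<integral>\<^sup>+x. f (x + g) \<partial>\<mu>) = c g * (\<integral>\<^sup>+x. f x \<partial>\<mu>)"
    by metis
  have c_emeasure: "emeasure \<mu> {x. x + g \<in> A} = c g * emeasure \<mu> A" if "open A" for g A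
  proof -
    have [measurable]: "A \<in> sets borel" using that by simp
    have "{x. x + g \<in> A} \<in> sets \<mu>"
      using open_right_translate[OF that] by simp
    then have "emeasure \<mu> {x. x + g \<in> A} = (\<integral>\<^sup>+x. indicator {x. x + g \<in> A} x \<partial>\<mu>)"
      by (rule nn_integral_indicator[symmetric])
    also have "\<dots> = (\<integral>\<^sup>+x. indicator A (x + g) \<partial>\<mu>)"
      by (intro nn_integral_cong) (simp add: indicator_def)
    also have "\<dots> = c g * (\<integral>\<^sup>+x. indicator A x \<partial>\<mu>)"
      by (rule c) measurable
    finally show ?thesis by simp
  qed
  obtain U K :: "'a set" where U: "open U" "0 \<in> U" and K: "compact K" "U \<subseteq> K"
    by (rule compact_neighbourhood)
  have finite_sub: "emeasure \<mu> A < \<infinity>" if "A \<subseteq> K'" "compact K'" for A K'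
  proof -
    have "emeasure \<mu> A \<le> emeasure \<mu> K'"
      using that by (intro emeasure_mono) (auto intro: borel_compact)
    then show ?thesis
      using emeasure_compact[OF that(2)] by (rule le_less_trans)
  qed
  have U_pos: "0 < emeasure \<mu> A" "emeasure \<mu> A < \<infinity>" if "open A" "0 \<in> A" "A \<subseteq> U" for A
    using that K finite_sub[of A K] by (auto intro: emeasure_open_pos)
  have c_pos: "0 < c g" "c g < \<infinity>" for g
  \<comment> \<open>The set of \<open>x\<close> with \<open>x + g\<close> in \<open>U\<close> is
    open, contains \<open>- g\<close>, and lies in a translate of the compact \<open>K\<close>; its
    measure \<open>c g * emeasure \<mu> U\<close> is therefore positive and finite.\<close>
  proof -
    have "- g \<in> {x. x + g \<in> U}"
      using U(2) by simp
    then have pos: "0 < emeasure \<mu> {x. x + g \<in> U}"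
      by (intro emeasure_open_pos open_right_translate U(1)) blast
    have "compact ((\<lambda>x. x + - g) ` K)"
      by (intro compact_continuous_image K) (auto simp: continuous_on_def intro!: tendsto_intros)
    moreover have "{x. x + g \<in> U} \<subseteq> (\<lambda>x. x + - g) ` K"
    proof
      fix x assume "x \<in> {x. x + g \<in> U}"
      then show "x \<in> (\<lambda>x. x + - g) ` K"
        using K(2) by (intro image_eqI[of _ _ "x + g"]) (auto simp: add.assoc)
    qed
    ultimately have fin: "emeasure \<mu> {x. x + g \<in> U} < \<infinity>"
      by (rule finite_sub[rotated])
    show "0 < c g"
      using pos by (auto simp: c_emeasure[OF U(1)] zero_less_iff_neq_zero)
    show "c g < \<infinity>"
      using fin U_pos(1)[OF U(1,2) order_refl]
      by (auto simp: c_emeasure[OF U(1)] ennreal_mult_less_top)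
  qed
  have c_add: "c (g + h) = c g * c h" for g h
  proof -
    have [measurable]: "U \<in> sets borel" using U by simp
    have "c (g + h) * emeasure \<mu> U = (\<integral>\<^sup>+x. indicator U (x + (g + h)) \<partial>\<mu>)"
      by (subst c[of "indicator U"]) simp_all
    also have "\<dots> = (\<integral>\<^sup>+x. indicator U ((x + g) + h) \<partial>\<mu>)"
      by (simp add: add.assoc)
    also have "\<dots> = c g * (\<integral>\<^sup>+x. indicator U (x + h) \<partial>\<mu>)"
      by (rule c[of "\<lambda>x. indicator U (x + h)"]) measurable
    also have "\<dots> = c g * (c h * emeasure \<mu> U)"
      by (subst c[of "indicator U"]) simp_all
    finally have "emeasure \<mu> U * c (g + h) = emeasure \<mu> U * (c g * c h)"
      by (simp add: ac_simps)
    then show ?thesis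
      using U_pos[OF U order_refl] by (auto simp: ennreal_mult_cancel_left)
  qed
  define r where "r g = enn2real (c g)" for g
  have r_pos: "0 < r g" for g
    using c_pos[of g] by (simp add: r_def enn2real_positive_iff)
  define \<rho> where "\<rho> g = ln (r g)" for g
  have \<rho>_add: "\<rho> (g + h) = \<rho> g + \<rho> h" for g h
  proof -
    have "r (g + h) = r g * r h"
      by (simp add: r_def c_add enn2real_mult)
    then show ?thesis
      unfolding \<rho>_def using r_pos[of g] r_pos[of h] by (simp add: ln_mult)
  qed
  have "continuous_on UNIV \<rho>"
  proof -
    \<comment> \<open>Continuity of subtraction gives neighbourhoods \<open>V\<close> and
      \<open>W\<close> of 0 with \<open>V - W\<close> inside \<open>U\<close>. For \<open>g\<close>
      in \<open>W\<close> the translate \<open>V - g\<close> lies in \<open>U\<close>, whence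
      \<open>c g * emeasure \<mu> V \<le> emeasure \<mu> U\<close>.\<close>
    have "continuous_on UNIV (\<lambda>p :: 'a \<times> 'a. fst p + - snd p)"
      unfolding continuous_on_def by (intro ballI tendsto_intros)
    then have "open ((\<lambda>p. fst p + - snd p) -` U)"
      by (rule open_vimage[OF U(1)])
    moreover have "(0, 0) \<in> (\<lambda>p. fst p + - snd p) -` U"
      using U by simp
    ultimately obtain A W where AW: "open A" "open W" "(0, 0) \<in> A \<times> W"
      "A \<times> W \<subseteq> (\<lambda>p. fst p + - snd p) -` U"
      by (rule open_prod_elim)
    define V where "V = A \<inter> U"
    have V: "open V" "0 \<in> V" "V \<subseteq> U"
      using AW U by (auto simp: V_def)
    have "r g \<le> enn2real (emeasure \<mu> U) / enn2real (emeasure \<mu> V)" if "g \<in> W" for g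
    proof -
      have "{x. x + g \<in> V} \<subseteq> U"
      proof
        fix x assume "x \<in> {x. x + g \<in> V}"
        then have "(x + g, g) \<in> A \<times> W"
          using that by (simp add: V_def)
        then have "x + g + - g \<in> U"
          using AW(4) by fastforce
        then show "x \<in> U"
          by (simp add: add.assoc)
      qed
      then have "c g * emeasure \<mu> V \<le> emeasure \<mu> U"
        unfolding c_emeasure[OF V(1), symmetric] using U(1) by (intro emeasure_mono) auto
      then have "r g * enn2real (emeasure \<mu> V) \<le> enn2real (emeasure \<mu> U)"
        unfolding r_def enn2real_mult[symmetric]
        using U_pos(2)[OF U order_refl] by (intro enn2real_mono) auto
      moreover have "0 < enn2real (emeasure \<mu> V)"
        using U_pos[OF V] by (simp add: enn2real_positive_iff)
      ultimately show ?thesis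
        by (simp add: pos_le_divide_eq)
    qed
    then have "\<rho> g \<le> ln (enn2real (emeasure \<mu> U) / enn2real (emeasure \<mu> V))" if "g \<in> W" for g
      unfolding \<rho>_def using that r_pos[of g] by (intro ln_mono) auto
    then show ?thesis
      using additive_bounded_above_imp_continuous[of \<rho> W, OF \<rho>_add] AW by blast
  qed
  then have "\<rho> g = 0"
    using hom \<rho>_add unfolding no_nontrivial_real_hom_def by blast
  then have "r g = 1"
    using r_pos[of g] by (simp add: \<rho>_def)
  moreover have "ennreal (r g) = c g"
    unfolding r_def using c_pos(2)[of g] by (intro ennreal_enn2real) simp
  ultimately have "c g = 1"
    by simp
  then show ?thesis
    using c[OF f, of g] by simp
qed

end

subsection \<open>Finite mixtures of image measures\<close>

text \<open>Indexing the entries with repetition presents them as the image of a uniform index, so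
  that \<open>pmf_of_multiset\<close> can be treated through uniform distributions on finite
  sets.\<close>

lemma pmf_of_multiset_eq_map_pmf:
  assumes "M \<noteq> {#}"
  obtains f :: "nat \<Rightarrow> 'b" where "M = image_mset f (mset_set {..<size M})"
    and "pmf_of_multiset M = map_pmf f (pmf_of_set {..<size M})"
proof -
  obtain xs where xs: "mset xs = M"
    using ex_mset by blast
  have "M = mset (map ((!) xs) [0..<length xs])"
    by (simp only: map_nth xs)
  also have "\<dots> = image_mset ((!) xs) (mset_set {..<size M})"
    by (simp add: xs[symmetric] atLeast0LessThan)
  finally have M: "M = image_mset ((!) xs) (mset_set {..<size M})" .
  moreover have "map_pmf ((!) xs) (pmf_of_set {..<size M}) = pmf_of_multiset (image_mset ((!) xs) (mset_set {..<size M}))"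
    using assms by (intro map_pmf_of_set) (auto simp: lessThan_empty_iff)
  ultimately show ?thesis
    using that by metis
qed

lemma map_pmf_of_multiset:
  assumes "M \<noteq> {#}"
  shows "map_pmf g (pmf_of_multiset M) = pmf_of_multiset (image_mset g M)"
proof -
  obtain f :: "nat \<Rightarrow> 'a" where f: "M = image_mset f (mset_set {..<size M})"
    "pmf_of_multiset M = map_pmf f (pmf_of_set {..<size M})"
    by (rule pmf_of_multiset_eq_map_pmf[OF assms])
  have "map_pmf g (pmf_of_multiset M) = map_pmf (g \<circ> f) (pmf_of_set {..<size M})"
    by (simp only: f(2) pmf.map_comp)
  also have "\<dots> = pmf_of_multiset (image_mset (g \<circ> f) (mset_set {..<size M}))"
    using assms by (intro map_pmf_of_set) (auto simp: lessThan_empty_iff)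
  also have "image_mset (g \<circ> f) (mset_set {..<size M}) = image_mset g M"
    by (subst (2) f(1)) (simp add: multiset.map_comp)
  finally show ?thesis .
qed

lemma nn_integral_pmf_of_multiset:
  assumes "M \<noteq> {#}" and "\<And>x. 0 \<le> h x"
  shows "(\<integral>\<^sup>+x. ennreal (h x) \<partial>pmf_of_multiset M) = ennreal ((\<Sum>x\<in>#M. h x) / real (size M))"
proof -
  obtain f :: "nat \<Rightarrow> 'a" where f: "M = image_mset f (mset_set {..<size M})"
    "pmf_of_multiset M = map_pmf f (pmf_of_set {..<size M})"
    by (rule pmf_of_multiset_eq_map_pmf[OF assms(1)])
  have "(\<integral>\<^sup>+x. ennreal (h x) \<partial>pmf_of_multiset M) = (\<Sum>i<size M. ennreal (h (f i))) / size M"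
    using assms by (simp add: f(2) nn_integral_pmf_of_set lessThan_empty_iff)
  also have "\<dots> = ennreal ((\<Sum>i<size M. h (f i)) / real (size M))"
    using assms by (simp add: sum_nonneg divide_ennreal ennreal_of_nat_eq_real_of_nat nonempty_has_size)
  also have "(\<Sum>i<size M. h (f i)) = (\<Sum>x\<in>#M. h x)"
    by (subst (2) f(1)) (simp add: multiset.map_comp sum_unfold_sum_mset comp_def)
  finally show ?thesis .
qed

text \<open>The index space is discrete, so it only matters that each value is a probability
  measure.\<close>

lemma measure_pmf_bind_distr_kernel:
  assumes "prob_space \<nu>" and "\<And>p. g p \<in> measurable \<nu> N"
  shows "(\<lambda>p. distr \<nu> N (g p)) \<in> measurable (measure_pmf Q) (subprob_algebra N)"
  using assms
  by (auto simp: space_subprob_algebra intro!: prob_space_imp_subprob_space prob_space.prob_space_distr)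

lemma sets_pmf_bind_distr [simp]: "sets (measure_pmf Q \<bind> (\<lambda>p. distr \<nu> N (g p))) = sets N"
  by (rule sets_bind) simp_all

text \<open>The bind is the law of \<open>g p x\<close> for independent \<open>p\<close> with law
  \<open>Q\<close> and \<open>x\<close> with law \<open>\<nu>\<close>.\<close>

lemma emeasure_pmf_bind_distr:
  assumes "prob_space \<nu>" and "\<And>p. g p \<in> measurable \<nu> N" and "A \<in> sets N"
  shows "emeasure (measure_pmf Q \<bind> (\<lambda>p. distr \<nu> N (g p))) A
    = (\<integral>\<^sup>+p. (\<integral>\<^sup>+x. indicator A (g p x) \<partial>\<nu>) \<partial>Q)"
proof -
  have "emeasure (measure_pmf Q \<bind> (\<lambda>p. distr \<nu> N (g p))) A = (\<integral>\<^sup>+p. emeasure (distr \<nu> N (g p)) A \<partial>Q)"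
    by (rule emeasure_bind[OF _ measure_pmf_bind_distr_kernel[OF assms(1,2)] assms(3)]) simp
  also have "\<dots> = (\<integral>\<^sup>+p. (\<integral>\<^sup>+x. indicator A (g p x) \<partial>\<nu>) \<partial>Q)"
  proof (rule nn_integral_cong)
    fix p
    have "emeasure (distr \<nu> N (g p)) A = (\<integral>\<^sup>+x. indicator A x \<partial>distr \<nu> N (g p))"
      using assms(3) by simp
    also have "\<dots> = (\<integral>\<^sup>+x. indicator A (g p x) \<partial>\<nu>)"
      using assms(2)[of p] assms(3) by (intro nn_integral_distr) simp_all
    finally show "emeasure (distr \<nu> N (g p)) A = (\<integral>\<^sup>+x. indicator A (g p x) \<partial>\<nu>)" .
  qed
  finally show ?thesis .
qed

lemma prob_space_pmf_bind_distr:
  assumes "prob_space \<nu>" and "\<And>p. g p \<in> measurable \<nu> N"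
  shows "prob_space (measure_pmf Q \<bind> (\<lambda>p. distr \<nu> N (g p)))"
proof (rule prob_spaceI)
  have sp: "space (measure_pmf Q \<bind> (\<lambda>p. distr \<nu> N (g p))) = space N"
    by (rule sets_eq_imp_space_eq) simp
  have "(\<integral>\<^sup>+x. indicator (space N) (g p x) \<partial>\<nu>) = 1" for p
  proof -
    have "(\<integral>\<^sup>+x. indicator (space N) (g p x) \<partial>\<nu>) = (\<integral>\<^sup>+x. 1 \<partial>\<nu>)"
      using measurable_space[OF assms(2)[of p]] by (intro nn_integral_cong) simp
    then show ?thesis
      using prob_space.emeasure_space_1[OF assms(1)] by simp
  qed
  then show "emeasure (measure_pmf Q \<bind> (\<lambda>p. distr \<nu> N (g p)))
      (space (measure_pmf Q \<bind> (\<lambda>p. distr \<nu> N (g p)))) = 1"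
    unfolding sp using assms by (simp add: emeasure_pmf_bind_distr)
qed

lemma distr_pmf_bind_distr:
  assumes "prob_space \<nu>" and "\<And>p. g p \<in> measurable \<nu> N" and f: "f \<in> measurable N N'"
  shows "distr (measure_pmf Q \<bind> (\<lambda>p. distr \<nu> N (g p))) N' f
    = measure_pmf Q \<bind> (\<lambda>p. distr \<nu> N' (\<lambda>x. f (g p x)))"
proof -
  have "distr (measure_pmf Q \<bind> (\<lambda>p. distr \<nu> N (g p))) N' f
      = measure_pmf Q \<bind> (\<lambda>p. distr (distr \<nu> N (g p)) N' f)"
    by (intro distr_bind[OF measure_pmf_bind_distr_kernel] assms) simp
  also have "(\<lambda>p. distr (distr \<nu> N (g p)) N' f) = (\<lambda>p. distr \<nu> N' (\<lambda>x. f (g p x)))"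
    using assms by (simp add: distr_distr comp_def)
  finally show ?thesis .
qed

lemma map_pmf_bind_distr:
  assumes "prob_space \<nu>" and "\<And>p. g p \<in> measurable \<nu> N"
  shows "measure_pmf (map_pmf k Q) \<bind> (\<lambda>p. distr \<nu> N (g p))
    = measure_pmf Q \<bind> (\<lambda>p. distr \<nu> N (g (k p)))"
  by (rule measure_eqI) (simp_all add: emeasure_pmf_bind_distr assms)

subsection \<open>From matchings to couplings of densities\<close>

text \<open>The right translate by \<open>y\<close> of a mixture of left translates of
  \<open>\<psi>\<close> is the density of \<open>a + x - y\<close>, where \<open>a\<close> has law
  \<open>P\<close> and \<open>x\<close> has density \<open>\<psi>\<close>. Left invariance removes
  \<open>a\<close>; unimodularity removes \<open>y\<close>.\<close>

lemma (in Haar_space) density_pmf_mixture: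
  fixes P :: "'a pmf" and \<psi> :: "'a \<Rightarrow> real"
  assumes hom: "no_nontrivial_real_hom TYPE('a)"
    and fin: "finite (set_pmf P)"
    and \<psi>_meas [measurable]: "\<psi> \<in> borel_measurable borel" and \<psi>: "\<And>x. 0 \<le> \<psi> x"
    and prob: "prob_space (density \<mu> (\<lambda>x. ennreal (\<psi> x)))"
  shows "density \<mu> (\<lambda>x. ennreal (\<Sum>a\<in>set_pmf P. pmf P a * \<psi> (- a + (x + y))))
    = measure_pmf P \<bind> (\<lambda>a. distr (density \<mu> (\<lambda>x. ennreal (\<psi> x))) borel (\<lambda>x. a + x - y))"
    (is "?L = ?R")
proof (rule measure_eqI)
  have sub_meas [measurable]: "(\<lambda>x. f x - y) \<in> borel_measurable borel"
    if [measurable]: "f \<in> borel_measurable borel" for f :: "'a \<Rightarrow> 'a"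
    unfolding diff_conv_add_uminus by measurable
  show "sets ?L = sets ?R" by simp
  fix A assume "A \<in> sets ?L"
  then have A [measurable]: "A \<in> sets borel" by simp
  have shift: "(\<integral>\<^sup>+x. ennreal (\<psi> (- a + (x + y))) * indicator A x \<partial>\<mu>)
      = (\<integral>\<^sup>+x. indicator A (a + x - y) \<partial>density \<mu> (\<lambda>x. ennreal (\<psi> x)))" for a
  proof -
    \<comment> \<open>Chosen so that the integrand is \<open>G (- a + (x + y))\<close>: there the
      argument of the indicator reduces to \<open>x\<close>.\<close>
    define G where "G x = ennreal (\<psi> x) * indicator A (a + x - y)" for x
    have [measurable]: "G \<in> borel_measurable borel"
      unfolding G_def by measurable
    have cancel: "a + (- a + (x + y)) - y = x" for x
      by (simp add: add.assoc[symmetric])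
    have "(\<integral>\<^sup>+x. ennreal (\<psi> (- a + (x + y))) * indicator A x \<partial>\<mu>) = (\<integral>\<^sup>+x. G (- a + (x + y)) \<partial>\<mu>)"
      unfolding G_def cancel ..
    also have "\<dots> = (\<integral>\<^sup>+x. G (- a + x) \<partial>\<mu>)"
      by (rule nn_integral_right_translate[OF hom, of "\<lambda>x. G (- a + x)"]) measurable
    also have "\<dots> = (\<integral>\<^sup>+x. G x \<partial>\<mu>)"
      by (rule nn_integral_left_translate) measurable
    also have "\<dots> = (\<integral>\<^sup>+x. indicator A (a + x - y) \<partial>density \<mu> (\<lambda>x. ennreal (\<psi> x)))"
      unfolding G_def by (intro nn_integral_density[symmetric]) measurable
    finally show ?thesis .
  qed
  have "emeasure ?L A = (\<integral>\<^sup>+x. ennreal (\<Sum>a\<in>set_pmf P. pmf P a * \<psi> (- a + (x + y))) * indicator A x \<partial>\<mu>)"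
    by (rule emeasure_density) measurable
  also have "\<dots> = (\<integral>\<^sup>+x. (\<Sum>a\<in>set_pmf P. ennreal (pmf P a) * (ennreal (\<psi> (- a + (x + y))) * indicator A x)) \<partial>\<mu>)"
    by (simp add: sum_ennreal[symmetric] \<psi> ennreal_mult sum_distrib_right mult.assoc)
  also have "\<dots> = (\<Sum>a\<in>set_pmf P. ennreal (pmf P a) * (\<integral>\<^sup>+x. ennreal (\<psi> (- a + (x + y))) * indicator A x \<partial>\<mu>))"
    by (subst nn_integral_sum) (simp_all add: nn_integral_cmult)
  also have "\<dots> = (\<integral>\<^sup>+a. (\<integral>\<^sup>+x. indicator A (a + x - y) \<partial>density \<mu> (\<lambda>x. ennreal (\<psi> x))) \<partial>P)"
    unfolding shift by (subst nn_integral_measure_pmf_finite[OF fin]) (simp_all add: mult.commute)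
  also have "\<dots> = emeasure ?R A"
    by (rule emeasure_pmf_bind_distr[symmetric]) (use prob A in simp_all)
  finally show "emeasure ?L A = emeasure ?R A" .
qed

text \<open>Joint continuity of subtraction at the points \<open>(0, c)\<close>, followed by
  compactness of \<open>C\<close>. \<open>F\<close> consists of inverses because the measure with
  density \<open>right_translate y f\<close> carries mass from \<open>x\<close> to
  \<open>x - y\<close>.\<close>

lemma compact_translates_approximation:
  fixes d :: "'a::topological_group_add \<Rightarrow> 'a \<Rightarrow> real"
  assumes comp: "compatible_metric d" and C: "compact C" and \<delta>: "0 < \<delta>"
  obtains F and U :: "'a set" where "finite F" "open U" "0 \<in> U"
    and "\<And>y. y \<in> C \<Longrightarrow> \<exists>y'\<in>F. \<forall>x\<in>U. d (x - y) y' < \<delta>"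
proof -
  interpret Metric_space UNIV d
    using comp by (simp add: compatible_metric_def)
  have "\<exists>A B. open A \<and> open B \<and> 0 \<in> A \<and> c \<in> B \<and> (\<forall>x\<in>A. \<forall>y\<in>B. d (x - y) (- c) < \<delta>)" for c
  proof -
    have "continuous_on UNIV (\<lambda>p :: 'a \<times> 'a. d (fst p + - snd p) (- c))"
      unfolding continuous_on_def
      by (intro ballI compatible_metric_continuous[OF comp] tendsto_intros)
    then have "open ((\<lambda>p :: 'a \<times> 'a. d (fst p + - snd p) (- c)) -` {..<\<delta>})"
      by (intro open_vimage) auto
    moreover have "(0, c) \<in> (\<lambda>p :: 'a \<times> 'a. d (fst p + - snd p) (- c)) -` {..<\<delta>}"
      using \<delta> by simp
    ultimately obtain A B where AB: "open A" "open B" "(0, c) \<in> A \<times> B"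
      "A \<times> B \<subseteq> (\<lambda>p. d (fst p + - snd p) (- c)) -` {..<\<delta>}"
      by (rule open_prod_elim)
    have "d (x - y) (- c) < \<delta>" if "x \<in> A" "y \<in> B" for x y
    proof -
      have "(x, y) \<in> A \<times> B" using that by simp
      then show ?thesis using AB(4) by fastforce
    qed
    then show ?thesis
      using AB(1-3) by blast
  qed
  then obtain A B where AB: "\<And>c. open (A c)" "\<And>c. open (B c)" "\<And>c. 0 \<in> A c" "\<And>c. c \<in> B c"
    "\<And>c x y. x \<in> A c \<Longrightarrow> y \<in> B c \<Longrightarrow> d (x - y) (- c) < \<delta>"
    by metis
  obtain C' where C': "C' \<subseteq> C" "finite C'" "C \<subseteq> (\<Union>c\<in>C'. B c)"
    using compactE_image[OF C, of C B] AB(2,4) by blast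
  show ?thesis
  proof
    show "finite (uminus ` C')" using C' by simp
    show "open (\<Inter>c\<in>C'. A c)" using C' AB by auto
    show "0 \<in> (\<Inter>c\<in>C'. A c)" using AB by auto
    fix y assume "y \<in> C"
    then obtain c where c: "c \<in> C'" "y \<in> B c" using C' by blast
    then show "\<exists>y'\<in>uminus ` C'. \<forall>x\<in>(\<Inter>c\<in>C'. A c). d (x - y) y' < \<delta>"
      using AB(5) by (intro bexI[of _ "- c"]) auto
  qed
qed

theorem theorem1p3:
  fixes \<mu> :: "'a::{topological_group_add, t2_space, second_countable_topology} measure"
    and d :: "'a \<Rightarrow> 'a \<Rightarrow> real"
  assumes "locally_compact_space (euclidean :: 'a topology)"
    and "amenable TYPE('a)"
    and "left_Haar_measure \<mu>"
    and "compatible_metric d"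
    and "left_invariant_metric d"
    and "no_nontrivial_real_hom TYPE('a)"
  shows "\<forall>C :: 'a set. \<forall>\<epsilon> :: real. compact C \<and> \<epsilon> > 0 \<longrightarrow>
           (\<exists>f. f \<in> L1_d_plus_1 \<mu> d \<and> compact (closure {x. f x \<noteq> 0}) \<and>
              (\<forall>y\<in>C. \<forall>z\<in>C.
                 Wasserstein \<mu> d (right_translate y f) (right_translate z f) < ennreal \<epsilon>))"
proof (intro allI impI, elim conjE)
  fix C :: "'a set" and \<epsilon> :: real
  assume C: "compact C" and \<epsilon>: "\<epsilon> > 0"
  interpret Haar_space \<mu>
    by standard (rule assms)+
  interpret Metric_space UNIV d
    using assms(4) by (simp add: compatible_metric_def)
  have d_left: "d (g + x) (g + y) = d x y" for g x y
    using assms(5) by (simp add: left_invariant_metric_def)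
  have d_cont: "continuous_on UNIV (\<lambda>p. d (fst p) (snd p))"
    unfolding continuous_on_def
    by (intro ballI compatible_metric_continuous[OF assms(4)] tendsto_intros)
  have d_meas: "(\<lambda>p. d (fst p) (snd p)) \<in> borel_measurable borel"
    by (rule borel_measurable_continuous_onI[OF d_cont])
  \<comment> \<open>Replacing \<open>x - y\<close> and \<open>x - z\<close> by elements of
    \<open>F\<close> costs \<open>\<epsilon> / 4\<close> each and the matching a further
    \<open>\<epsilon> / 4\<close>, so the total stays strictly below
    \<open>\<epsilon>\<close>.\<close>
  obtain F U0 where F: "finite F" "open U0" "0 \<in> U0"
    and approx: "\<And>y. y \<in> C \<Longrightarrow> \<exists>y'\<in>F. \<forall>x\<in>U0. d (x - y) y' < \<epsilon> / 4"
    using compact_translates_approximation[OF assms(4) C, of "\<epsilon> / 4"] \<epsilon> by auto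
  obtain U1 K where U1: "open U1" "0 \<in> U1" "compact K" "U1 \<subseteq> (K :: 'a set)"
    by (rule compact_neighbourhood)
  define U where "U = U0 \<inter> U1"
  have U: "open U" "0 \<in> U" "U \<subseteq> K" "U \<subseteq> U0"
    using F U1 by (auto simp: U_def)
  have U_sets [measurable]: "U \<in> sets borel"
    using U by simp
  obtain w s where w: "w \<noteq> {#}"
    and marginal: "\<And>i. i \<in> F \<times> F \<Longrightarrow> image_mset fst (s i) = w \<and> image_mset snd (s i) = w"
    and cost: "\<And>i. i \<in> F \<times> F \<Longrightarrow>
      (\<Sum>p\<in>#s i. d (fst p + fst i) (snd p + snd i)) < \<epsilon> / 4 * real (size w)"
    using amenable_approximate_transport[OF assms(2,4,5,6), of "F \<times> F" "\<epsilon> / 4"] F(1) \<epsilon> by auto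

  \<comment> \<open>The normalised bump on \<open>U\<close> and its mixture of left
    translates\<close>
  define m where "m = measure \<mu> U"
  have "emeasure \<mu> U \<le> emeasure \<mu> K"
    using U U1 by (intro emeasure_mono) (auto intro: borel_compact)
  then have "emeasure \<mu> U < \<infinity>"
    using emeasure_compact[OF U1(3)] by (rule le_less_trans)
  then have m: "emeasure \<mu> U = ennreal m"
    by (simp add: m_def emeasure_eq_ennreal_measure)
  have m_pos: "m > 0"
    using emeasure_open_pos[OF U(1)] U(2) m by auto
  define \<psi> where "\<psi> x = indicator U x / m" for x
  have \<psi>_meas [measurable]: "\<psi> \<in> borel_measurable borel"
    unfolding \<psi>_def by measurable
  have \<psi>_nonneg: "0 \<le> \<psi> x" for x
    using m_pos by (simp add: \<psi>_def)
  define \<nu> where "\<nu> = density \<mu> (\<lambda>x. ennreal (\<psi> x))"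
  have sets_\<nu> [measurable_cong, simp]: "sets \<nu> = sets borel"
    by (simp add: \<nu>_def)
  have space_\<nu> [simp]: "space \<nu> = UNIV"
    by (simp add: \<nu>_def)
  have prob_\<nu>: "prob_space \<nu>"
  proof (rule prob_spaceI)
    have "emeasure \<nu> (space \<nu>) = (\<integral>\<^sup>+x. ennreal (\<psi> x) \<partial>\<mu>)"
      by (simp add: \<nu>_def emeasure_density)
    also have "\<dots> = (\<integral>\<^sup>+x. ennreal (1 / m) * indicator U x \<partial>\<mu>)"
      by (intro nn_integral_cong) (simp add: \<psi>_def indicator_def)
    also have "\<dots> = ennreal (1 / m) * ennreal m"
      by (simp add: nn_integral_cmult_indicator m)
    also have "\<dots> = 1"
      using m_pos by (simp add: ennreal_mult[symmetric])
    finally show "emeasure \<nu> (space \<nu>) = 1" .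
  qed
  have AE_\<nu>: "AE x in \<nu>. x \<in> U"
    unfolding \<nu>_def by (subst AE_density) (auto simp: \<psi>_def indicator_def)

  define P where "P = pmf_of_multiset w"
  have set_P: "set_pmf P = set_mset w"
    using w by (simp add: P_def)
  \<comment> \<open>The density of \<open>a + x\<close> for independent \<open>a\<close>, uniform in
    \<open>w\<close> with multiplicity, and \<open>x\<close>, uniform on \<open>U\<close>.\<close>
  define f where "f x = (\<Sum>a\<in>set_pmf P. pmf P a * \<psi> (- a + x))" for x
  have f_meas [measurable]: "f \<in> borel_measurable borel"
    unfolding f_def by measurable
  have f_nonneg: "0 \<le> f x" for x
    unfolding f_def by (intro sum_nonneg mult_nonneg_nonneg \<psi>_nonneg) simp
  have density_f: "density \<mu> (\<lambda>x. ennreal (right_translate y f x))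
      = measure_pmf P \<bind> (\<lambda>a. distr \<nu> borel (\<lambda>x. a + x - y))" for y
    unfolding right_translate_def f_def \<nu>_def
    by (rule density_pmf_mixture) (use assms(6) set_P \<psi>_nonneg prob_\<nu> in \<open>simp_all add: \<nu>_def\<close>)
  have trans_meas [measurable]: "(\<lambda>x. a + x - y) \<in> borel_measurable borel" for a y :: 'a
    unfolding diff_conv_add_uminus by measurable
  have nn_f: "(\<integral>\<^sup>+x. ennreal (f x) \<partial>\<mu>) = 1"
  proof -
    \<comment> \<open>The case \<open>y = 0\<close> of \<open>density_f\<close> identifies
      \<open>f\<close> as the density of a probability measure.\<close>
    have "(\<integral>\<^sup>+x. ennreal (f x) \<partial>\<mu>) = emeasure (density \<mu> (\<lambda>x. ennreal (right_translate 0 f x))) UNIV"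
      by (simp add: emeasure_density right_translate_def)
    also have "\<dots> = 1"
      unfolding density_f
      using prob_space.emeasure_space_1[OF prob_space_pmf_bind_distr[OF prob_\<nu>, of "\<lambda>a x. a + x - 0" borel P]]
      by (simp add: sets_eq_imp_space_eq[OF sets_pmf_bind_distr] del: diff_0_right diff_zero)
    finally show ?thesis .
  qed

  \<comment> \<open>Compact support and finite first moment\<close>
  define KK where "KK = (\<Union>a\<in>set_mset w. (\<lambda>x. a + x) ` K)"
  have "compact KK"
    unfolding KK_def
    by (intro compact_UN compact_continuous_image U1(3))
      (auto simp: continuous_on_def intro!: tendsto_intros)
  have f_supp: "x \<in> KK" if fx: "f x \<noteq> 0" for x
  proof -
    have "\<not> (\<forall>a\<in>set_pmf P. pmf P a * \<psi> (- a + x) = 0)"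
    proof
      assume "\<forall>a\<in>set_pmf P. pmf P a * \<psi> (- a + x) = 0"
      then have "f x = 0"
        unfolding f_def by (rule sum.neutral)
      then show False using fx by simp
    qed
    then obtain a where "a \<in> set_pmf P" "\<psi> (- a + x) \<noteq> 0"
      by auto
    then have "- a + x \<in> K" "a \<in> set_mset w"
      using U(3) by (auto simp: \<psi>_def indicator_def set_P split: if_splits)
    moreover have "x = a + (- a + x)"
      by (simp add: add.assoc[symmetric])
    ultimately show ?thesis
      unfolding KK_def by blast
  qed
  have "closure {x. f x \<noteq> 0} \<subseteq> KK"
    using f_supp compact_imp_closed[OF \<open>compact KK\<close>] by (intro closure_minimal) auto
  then have f_compact: "compact (closure {x. f x \<noteq> 0})"
    using compact_Int_closed[OF \<open>compact KK\<close> closed_closure, of "{x. f x \<noteq> 0}"]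
    by (simp add: Int_absorb1)

  have "f \<in> L1_d_plus_1 \<mu> d"
    unfolding L1_d_plus_1_def
  proof (intro CollectI conjI)
    show "integrable \<mu> f"
      using nn_f f_nonneg by (intro integrableI_nonneg) auto
    show "AE x in \<mu>. 0 \<le> f x"
      using f_nonneg by simp
    show "(\<integral>x. \<bar>f x\<bar> \<partial>\<mu>) = 1"
      using nn_f f_nonneg by (simp add: integral_eq_nn_integral)
    have "continuous_on KK (\<lambda>x. d x 0)"
      unfolding continuous_on_def
      by (intro ballI compatible_metric_continuous[OF assms(4)] tendsto_intros)
    then have "bounded ((\<lambda>x. d x 0) ` KK)"
      using \<open>compact KK\<close> by (intro compact_imp_bounded compact_continuous_image)
    then obtain B where B: "\<And>x. x \<in> KK \<Longrightarrow> \<bar>d x 0\<bar> \<le> B"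
      by (auto simp: bounded_iff)
    \<comment> \<open>The absolute value keeps the bound nonnegative without exhibiting a point of
      \<open>KK\<close>.\<close>
    have "(\<integral>\<^sup>+x. ennreal (d x 0 * f x) \<partial>\<mu>) \<le> (\<integral>\<^sup>+x. ennreal \<bar>B\<bar> * ennreal (f x) \<partial>\<mu>)"
    proof (rule nn_integral_mono)
      fix x
      have "d x 0 * f x \<le> \<bar>B\<bar> * f x"
      proof (cases "f x = 0")
        case False
        then have "d x 0 \<le> \<bar>B\<bar>"
          using B[OF f_supp] by fastforce
        then show ?thesis
          using f_nonneg by (rule mult_right_mono)
      qed simp
      then show "ennreal (d x 0 * f x) \<le> ennreal \<bar>B\<bar> * ennreal (f x)"
        using f_nonneg[of x] by (simp add: ennreal_mult[symmetric] ennreal_leI)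
    qed
    also have "\<dots> = ennreal \<bar>B\<bar>"
      by (simp add: nn_integral_cmult nn_f)
    finally show "(\<integral>\<^sup>+x. ennreal (d x 0 * f x) \<partial>\<mu>) < \<infinity>"
      by (rule le_less_trans) simp
  qed

  \<comment> \<open>The coupling of two right translates\<close>
  moreover have "Wasserstein \<mu> d (right_translate y f) (right_translate z f) < ennreal \<epsilon>"
    if yz: "y \<in> C" "z \<in> C" for y z
  proof -
    obtain y' z' where y': "y' \<in> F" "\<And>x. x \<in> U \<Longrightarrow> d (x - y) y' < \<epsilon> / 4"
      and z': "z' \<in> F" "\<And>x. x \<in> U \<Longrightarrow> d (x - z) z' < \<epsilon> / 4"
      using approx[OF yz(1)] approx[OF yz(2)] U(4) by blast
    define M where "M = s (y', z')"
    have M: "image_mset fst M = w" "image_mset snd M = w"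
      and M_cost: "(\<Sum>p\<in>#M. d (fst p + y') (snd p + z')) < \<epsilon> / 4 * real (size w)"
      using marginal[of "(y', z')"] cost[of "(y', z')"] y'(1) z'(1) by (auto simp: M_def)
    have "M \<noteq> {#}" using M w by auto
    have size_M: "size M = size w"
      unfolding M(1)[symmetric] by simp
    have w_pos: "real (size w) > 0"
      using w by (simp add: nonempty_has_size[symmetric])
    define Q where "Q = pmf_of_multiset M"
    have Q_fst: "map_pmf fst Q = P" and Q_snd: "map_pmf snd Q = P"
      unfolding Q_def P_def by (simp_all add: map_pmf_of_multiset[OF \<open>M \<noteq> {#}\<close>] M)
    \<comment> \<open>A matched pair \<open>p\<close> is drawn from \<open>Q\<close>, and one and
      the same bump point \<open>x\<close> is used in both coordinates. Since both marginals of
      \<open>Q\<close> are \<open>P\<close>, the marginals of the resulting law are the two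
      translates.\<close>
    define G where "G p x = (fst p + x - y, snd p + x - z)" for p :: "'a \<times> 'a" and x
    have "continuous_on UNIV (G p)" for p
      unfolding G_def continuous_on_def diff_conv_add_uminus by (intro ballI tendsto_intros)
    then have G_meas: "G p \<in> measurable \<nu> borel" for p
      using borel_measurable_continuous_onI[of "G p"] by (simp cong: measurable_cong_sets)
    have fst_meas: "fst \<in> borel_measurable (borel :: ('a \<times> 'a) measure)"
      and snd_meas: "snd \<in> borel_measurable (borel :: ('a \<times> 'a) measure)"
      by (auto intro!: borel_measurable_continuous_onI continuous_on_fst continuous_on_snd continuous_on_id)
    have meas1: "(\<lambda>x. a + x - b) \<in> measurable \<nu> borel" for a b
      using trans_meas[of a b] by (simp cong: measurable_cong_sets)
    define \<eta> where "\<eta> = measure_pmf Q \<bind> (\<lambda>p. distr \<nu> borel (G p))"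
    have "distr \<eta> borel fst = density \<mu> (\<lambda>x. ennreal (right_translate y f x))"
      unfolding \<eta>_def distr_pmf_bind_distr[OF prob_\<nu> G_meas fst_meas] density_f Q_fst[symmetric]
        map_pmf_bind_distr[OF prob_\<nu> meas1] by (simp add: G_def)
    moreover have "distr \<eta> borel snd = density \<mu> (\<lambda>x. ennreal (right_translate z f x))"
      unfolding \<eta>_def distr_pmf_bind_distr[OF prob_\<nu> G_meas snd_meas] density_f Q_snd[symmetric]
        map_pmf_bind_distr[OF prob_\<nu> meas1] by (simp add: G_def)
    ultimately have "\<eta> \<in> couplings \<mu> (right_translate y f) (right_translate z f)"
      unfolding couplings_def \<eta>_def using prob_space_pmf_bind_distr[OF prob_\<nu> G_meas]
      by simp
    then have "Wasserstein \<mu> d (right_translate y f) (right_translate z f)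
        \<le> (\<integral>\<^sup>+(u, v). ennreal (d u v) \<partial>\<eta>)"
      unfolding Wasserstein_def by (rule INF_lower)
    also have "\<dots> = (\<integral>\<^sup>+p. \<integral>\<^sup>+q. (case q of (u, v) \<Rightarrow> ennreal (d u v)) \<partial>distr \<nu> borel (G p) \<partial>Q)"
      unfolding \<eta>_def
      by (rule nn_integral_bind[OF _ measure_pmf_bind_distr_kernel[OF prob_\<nu> G_meas]])
        (use d_meas in \<open>simp add: case_prod_unfold\<close>)
    also have "\<dots> \<le> (\<integral>\<^sup>+p. ennreal (\<epsilon> / 2 + d (fst p + y') (snd p + z')) \<partial>Q)"
    proof (rule nn_integral_mono)
      fix p
      have "(\<integral>\<^sup>+q. (case q of (u, v) \<Rightarrow> ennreal (d u v)) \<partial>distr \<nu> borel (G p))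
          = (\<integral>\<^sup>+x. ennreal (d (fst p + x - y) (snd p + x - z)) \<partial>\<nu>)"
        using d_meas by (subst nn_integral_distr[OF G_meas]) (simp_all add: case_prod_unfold G_def)
      also have "\<dots> \<le> (\<integral>\<^sup>+x. ennreal (\<epsilon> / 2 + d (fst p + y') (snd p + z')) \<partial>\<nu>)"
      proof (rule nn_integral_mono_AE)
        show "AE x in \<nu>. ennreal (d (fst p + x - y) (snd p + x - z))
            \<le> ennreal (\<epsilon> / 2 + d (fst p + y') (snd p + z'))"
          using AE_\<nu>
        proof (rule eventually_mono)
          fix x assume x: "x \<in> U"
          \<comment> \<open>Left invariance strips off \<open>fst p\<close> and
            \<open>snd p\<close>, so the errors are uniform over the possibly far apart points of
            \<open>w\<close>.\<close>
          have "d (fst p + x - y) (fst p + y') < \<epsilon> / 4" "d (snd p + x - z) (snd p + z') < \<epsilon> / 4"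
            using y'(2)[OF x] z'(2)[OF x] by (simp_all add: add_diff_eq[symmetric] d_left)
          moreover have "d (fst p + x - y) (snd p + x - z)
              \<le> d (fst p + x - y) (fst p + y') + d (fst p + y') (snd p + x - z)"
            "d (fst p + y') (snd p + x - z)
              \<le> d (fst p + y') (snd p + z') + d (snd p + z') (snd p + x - z)"
            by (intro triangle; simp)+
          ultimately have "d (fst p + x - y) (snd p + x - z) \<le> \<epsilon> / 2 + d (fst p + y') (snd p + z')"
            using commute[of "snd p + z'" "snd p + x - z"] by linarith
          then show "ennreal (d (fst p + x - y) (snd p + x - z))
            \<le> ennreal (\<epsilon> / 2 + d (fst p + y') (snd p + z'))"
            by (rule ennreal_leI)
        qed
      qed
      also have "\<dots> = ennreal (\<epsilon> / 2 + d (fst p + y') (snd p + z'))"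
        using prob_space.emeasure_space_1[OF prob_\<nu>] by simp
      finally show "(\<integral>\<^sup>+q. (case q of (u, v) \<Rightarrow> ennreal (d u v)) \<partial>distr \<nu> borel (G p))
          \<le> ennreal (\<epsilon> / 2 + d (fst p + y') (snd p + z'))" .
    qed
    also have "\<dots> = ennreal ((\<Sum>p\<in>#M. \<epsilon> / 2 + d (fst p + y') (snd p + z')) / real (size w))"
      unfolding Q_def size_M[symmetric] using \<epsilon>
      by (intro nn_integral_pmf_of_multiset \<open>M \<noteq> {#}\<close>) simp
    also have "\<dots> < ennreal \<epsilon>"
    proof (rule ennreal_lessI[OF \<epsilon>])
      have "(\<Sum>p\<in>#M. \<epsilon> / 2 + d (fst p + y') (snd p + z')) =
          real (size w) * (\<epsilon> / 2) + (\<Sum>p\<in>#M. d (fst p + y') (snd p + z'))"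
        by (simp add: sum_mset.distrib size_M)
      also have "\<dots> < real (size w) * (\<epsilon> / 2) + \<epsilon> / 4 * real (size w)"
        using M_cost by simp
      also have "\<dots> \<le> \<epsilon> * real (size w)"
        using \<epsilon> w_pos by (simp add: field_simps)
      finally show "(\<Sum>p\<in>#M. \<epsilon> / 2 + d (fst p + y') (snd p + z')) / real (size w) < \<epsilon>"
        using w_pos by (simp add: pos_divide_less_eq)
    qed
    finally show ?thesis .
  qed
  ultimately show "\<exists>f. f \<in> L1_d_plus_1 \<mu> d \<and> compact (closure {x. f x \<noteq> 0}) \<and>
      (\<forall>y\<in>C. \<forall>z\<in>C. Wasserstein \<mu> d (right_translate y f) (right_translate z f) < ennreal \<epsilon>)"
    using f_compact by blast
qed

end
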